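(* Let $k\ge 2$ be a fixed integer and let $G$ be a graph on $n$ vertices, where $n\ge (20k)^{4k^3+2k^2}$. If \[ |E(G)| > 16\sqrt{5}\sqrt{k\log k}\cdot n^{1+1/k} + 8000k^{4}\, n^{1+(2k-1)/(2k^2)}, \] then $G$ contains a copy of the cycle $C_{2k}$ (as a subgraph).
   Context: $\log$ denotes the natural logarithm. $C_{2k}$ is the cycle on $2k$ vertices. *)

theory Defs
  imports "HOL-Analysis.Analysis"
begin

record 'a ugraph =
  verts :: "'a set"
  edges :: "'a set set"

definition finite_simple_graph :: "'a ugraph \<Rightarrow> bool" where
  "finite_simple_graph G \<longleftrightarrow>
     finite (verts G) \<and> (\<forall>e\<in>edges G. e \<subseteq> verts G \<and> card e = 2)"

text \<open>A copy is a not necessarily induced subgraph isomorphic to \<open>H\<close>,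
  given here by the embedding of \<open>H\<close> onto it.\<close>

definition contains_copy :: "'a ugraph \<Rightarrow> 'b ugraph \<Rightarrow> bool" where
  "contains_copy G H \<longleftrightarrow>
     (\<exists>f. inj_on f (verts H) \<and> f ` verts H \<subseteq> verts G \<and> (\<forall>e\<in>edges H. f ` e \<in> edges G))"

text \<open>This is the cycle on \<open>m\<close> vertices only for \<open>m \<ge> 3\<close>.\<close>

definition cycle_graph :: "nat \<Rightarrow> nat ugraph" where
  "cycle_graph m = \<lparr>verts = {..<m}, edges = (\<lambda>i. {i, Suc i mod m}) ` {..<m}\<rparr>"

lemma finite_simple_graph_cycle_graph:
  assumes "m \<ge> 3"
  shows "finite_simple_graph (cycle_graph m)"
  using assms by (auto simp: finite_simple_graph_def cycle_graph_def mod_Suc card_insert_if)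

lemma card_edges_cycle_graph:
  assumes "m \<ge> 3"
  shows "card (edges (cycle_graph m)) = m"
proof -
  have "inj_on (\<lambda>i. {i, Suc i mod m}) {..<m}"
    using assms by (auto simp: inj_on_def doubleton_eq_iff mod_Suc split: if_splits)
  then show ?thesis
    by (simp add: cycle_graph_def card_image)
qed

end

theory Submission
  imports Defs
begin

text \<open>A theta graph is a cycle of length at least \<open>2 * k\<close> with a chord. Pass to a bipartite subgraph of
  minimum degree \<open>d\<close> and let \<open>L i\<close> be the vertices at distance \<open>i\<close> from a root. As observed by Bukh and
  Jiang, if a theta graph in \<open>L (i - 1)\<close>, \<open>L i\<close>, \<open>L (i + 1)\<close> is well placed, that is, if each of its
  vertices in \<open>L i\<close> has a neighbour in \<open>L (i - 1)\<close> off the theta graph, then there is a cycle of length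
  \<open>2 * k\<close>: a path of prescribed even length in the theta graph is closed up through the upper layers.

  Well-placed theta graphs are found by growing a path that visits \<open>L (i - 1)\<close> rarely. If the vertices of
  \<open>U \<subseteq> L i\<close> have \<open>b\<close> neighbours in \<open>L (i - 1)\<close>, then \<open>U\<close> sends to the average vertex of \<open>L (i + 1)\<close> no more
  than about \<open>8 * k / b\<close> edges. Adding this up over the superlevel sets of the degree
  into \<open>L (i - 1)\<close>, where the harmonic sum contributes the logarithm, gives that \<open>card (L (i + 1))\<close> is at
  least of order \<open>d\<^sup>2 / (k * ln k) * card (L (i - 1))\<close>, which forces \<open>L k\<close> to be larger than the graph.\<close>

section \<open>Colourings of a cycle with a chord\<close>

text \<open>The obstacle is well-placedness: a greedy path may use up all the neighbours that one of
  its vertices has in \<open>L (i - 1)\<close>. The remedy is a trade-off. If a vertex has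
  \<open>b\<close> such neighbours and nearly all of them lie on the path, then about
  \<open>b / 2\<close> lie on one side of it. If the path visits \<open>L (i - 1)\<close> only once
  in \<open>2 * T\<close> steps, these span about \<open>T * b\<close> steps, and for
  \<open>T\<close> about \<open>2 * k / b\<close> this is long enough for a theta graph. Between two
  visits the path goes back and forth between \<open>L i\<close> and \<open>L (i + 1)\<close> and
  has to land in vertices from which it can still go on. The number of forbidden vertices multiplies
  by at most 5 with each return to \<open>L i\<close>, so that a step out of
  \<open>L (i - 1)\<close> needs a degree of order \<open>k * 5 ^ T\<close>. This large cost falls
  on \<open>L (i - 1)\<close> only, where it is of lower order because \<open>d\<close> is large; a
  vertex of \<open>L (i + 1)\<close> is charged with \<open>T\<close> alone, whence the
  \<open>8 * k / b\<close>. The resulting comparison is between \<open>L (i - 1)\<close> and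
  \<open>L (i + 1)\<close>, so growth is measured over two layers at a time.\<close>

definition theta :: "('a \<Rightarrow> 'a \<Rightarrow> bool) \<Rightarrow> nat \<Rightarrow> 'a list \<Rightarrow> bool" where
  "theta E k c \<longleftrightarrow> distinct c \<and> successively E c \<and> 2 * k \<le> length c \<and> E (last c) (hd c) \<and>
     (\<exists>r. 2 \<le> r \<and> r + 2 \<le> length c \<and> E (hd c) (c ! r))"

lemma period_mult:
  fixes \<phi> :: "int \<Rightarrow> bool"
  assumes "\<And>x. \<phi> (x + a) = \<phi> x" "a dvd y - x"
  shows "\<phi> x = \<phi> y"
proof -
  have mult: "\<phi> (x + n * a) = \<phi> x" for n x
  proof (induction n arbitrary: x rule: int_induct[where k = 0])
    case (step1 i)
    have "\<phi> (x + (i + 1) * a) = \<phi> ((x + i * a) + a)" by (simp add: algebra_simps)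
    with step1 assms show ?case by simp
  next
    case (step2 i)
    have "\<phi> (x + i * a) = \<phi> ((x + (i - 1) * a) + a)" by (simp add: algebra_simps)
    with step2 assms show ?case by simp
  qed simp
  obtain n where "y = x + n * a" using assms(2) by (metis dvdE add.commute diff_add_cancel mult.commute)
  then show ?thesis using mult by simp
qed

lemma period_gcd:
  fixes \<phi> :: "int \<Rightarrow> bool"
  assumes "\<And>x. \<phi> (x + a) = \<phi> x" and "\<And>x. \<phi> (x + b) = \<phi> x"
  shows "\<phi> (x + gcd a b) = \<phi> x"
proof -
  obtain u v where uv: "u * a + v * b = gcd a b" using bezout_int by blast
  have "\<phi> x = \<phi> (x + u * a)" by (rule period_mult[where \<phi> = \<phi>, OF assms(1)]) simp
  also have "\<dots> = \<phi> (x + gcd a b)"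
    by (rule period_mult[where \<phi> = \<phi>, OF assms(2)]) (simp add: uv[symmetric])
  finally show ?thesis by simp
qed

lemma residue_in_interval:
  fixes lo x p :: int assumes "p > 0"
  obtains j where "lo \<le> j" "j < lo + p" "p dvd j - x"
proof
  show "lo \<le> lo + (x - lo) mod p" "lo + (x - lo) mod p < lo + p" using assms by auto
  have "p dvd (x - lo) mod p - (x - lo)" by (simp add: mod_eq_dvd_iff[symmetric])
  then show "p dvd lo + (x - lo) mod p - x" by (simp add: algebra_simps)
qed

text \<open>A colouring of the cycle \<open>\<int>/m\<close> with a chord \<open>0 - r\<close> that every path of length \<open>l\<close> preserves
  has period 2: the arcs make it periodic, and the paths through the chord reflect it in two different centres.\<close>

lemma periodic_two:
  fixes \<phi> :: "int \<Rightarrow> bool" and m l r :: int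
  assumes m: "\<And>x. \<phi> (x + m) = \<phi> x" and l: "\<And>x. \<phi> (x + l) = \<phi> x"
    and bounds: "0 < l" "l < m" "2 \<le> r" "r + 2 \<le> m"
    and up: "\<And>j. l \<le> m - r \<Longrightarrow> 0 \<le> j \<Longrightarrow> j < l \<Longrightarrow> \<phi> (- j) = \<phi> (r + l - 1 - j)"
    and down: "\<And>j. l \<le> r \<Longrightarrow> 0 \<le> j \<Longrightarrow> j < l \<Longrightarrow> \<phi> j = \<phi> (r - l + 1 + j)"
    and refl1: "\<And>j. 0 \<le> j \<Longrightarrow> j < r \<Longrightarrow> j < l \<Longrightarrow> r + l - 1 - j < m \<Longrightarrow> \<phi> j = \<phi> (r + l - 1 - j)"
    and refl2: "\<And>j. 0 \<le> j \<Longrightarrow> j < m - r \<Longrightarrow> j < l \<Longrightarrow> r - (l - 1 - j) > 0 \<Longrightarrow> \<phi> (- j) = \<phi> (r - (l - 1 - j))"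
  shows "\<phi> (x + 2) = \<phi> x"
proof -
  define g where "g = gcd l m"
  have g: "\<phi> (x + g) = \<phi> x" for x unfolding g_def using period_gcd[of \<phi> l m] l m by blast
  have gpos: "g > 0" using bounds by (simp add: g_def)
  have gl: "g dvd l" "g dvd m" by (auto simp: g_def)
  have gle: "g \<le> l" "g \<le> m - l" using gl bounds by (auto intro!: zdvd_imp_le)
  \<comment> \<open>The period \<open>p\<close> is so short that \<open>p\<close> consecutive values
    of \<open>j\<close> fit into the range of each reflection: from \<open>max 0 (l + r - m)\<close>
    to below \<open>min r l\<close> for \<open>refl1\<close>, from \<open>max 0 (l - r)\<close> to
    below \<open>min (m - r) l\<close> for \<open>refl2\<close>. Since \<open>p dvd l\<close>, the
    \<open>l\<close> in the centres of reflection drops out.\<close>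
  obtain p where p: "p > 0" "p \<le> l" "p \<le> m - l" "p \<le> r" "p \<le> m - r" "p dvd l" "\<And>x. \<phi> (x + p) = \<phi> x"
  proof (cases "g \<le> r \<and> g \<le> m - r")
    case True
    then show ?thesis using that[of g] g gpos gle gl by auto
  next
    case False
    then consider "r < g" | "m - r < g" by linarith
    then show ?thesis
    proof cases
      case 1
      then have lm: "l \<le> m - r" using gle by linarith
      \<comment> \<open>As \<open>l \<le> m - r\<close>, a path may run up to \<open>0\<close>,
        cross the chord and go up from \<open>r\<close>, whatever \<open>j\<close> is. As
        \<open>g \<le> l\<close>, these \<open>j\<close> meet every residue modulo \<open>g\<close>,
        and the translation by \<open>r + l - 1\<close> amounts to one by
        \<open>r - 1\<close>.\<close>
      have shift: "\<phi> (x + (r - 1)) = \<phi> x" for x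
      proof -
        obtain j where j: "0 \<le> j" "j < g" "g dvd j - (- x)" using residue_in_interval[OF gpos, of 0 "- x"] by auto
        have "\<phi> x = \<phi> (- j)" using j(3) by (intro period_mult[where \<phi> = \<phi>, OF g]) (metis add.inverse_inverse diff_minus_eq_add dvd_minus_iff minus_add_distrib uminus_add_conv_diff add.commute)
        also have "\<dots> = \<phi> (r + l - 1 - j)" using up[OF lm, of j] j gle by simp
        also have "\<dots> = \<phi> (x + (r - 1))"
        proof (rule period_mult[where \<phi> = \<phi>, OF g])
          have "x + (r - 1) - (r + l - 1 - j) = (j - (- x)) - l" by simp
          then show "g dvd x + (r - 1) - (r + l - 1 - j)" using j(3) gl by (metis dvd_diff)
        qed
        finally show ?thesis by simp
      qed
      define p where "p = gcd g (r - 1)"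
      have "p \<le> r - 1" unfolding p_def using bounds by (intro zdvd_imp_le) auto
      moreover have "p > 0" "p dvd g" using gpos by (auto simp: p_def)
      moreover have "p \<le> g" using \<open>p dvd g\<close> gpos by (intro zdvd_imp_le)
      moreover have "\<phi> (x + p) = \<phi> x" for x unfolding p_def using period_gcd[of \<phi> g "r - 1"] g shift by blast
      moreover have "p dvd l" using \<open>p dvd g\<close> gl(1) by (rule dvd_trans)
      ultimately show ?thesis using gle lm 1 by (intro that[of p]) auto
    next
      case 2
      then have lm: "l \<le> r" using gle by linarith
      \<comment> \<open>The mirror image: paths down to \<open>0\<close> and down from
        \<open>r\<close> translate by \<open>r + 1\<close>. The period \<open>m\<close> turns this
        into \<open>m - r - 1\<close>, so that the gcd with \<open>g\<close> stays below
        \<open>m - r\<close>.\<close>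
      have shift: "\<phi> (x + (r + 1)) = \<phi> x" for x
      proof -
        obtain j where j: "0 \<le> j" "j < g" "g dvd j - x" using residue_in_interval[OF gpos, of 0 x] by auto
        have "\<phi> x = \<phi> j" using j(3) by (intro period_mult[where \<phi> = \<phi>, OF g])
        also have "\<dots> = \<phi> (r - l + 1 + j)" using down[OF lm, of j] j gle by simp
        also have "\<dots> = \<phi> (x + (r + 1))"
        proof (rule period_mult[where \<phi> = \<phi>, OF g])
          have "x + (r + 1) - (r - l + 1 + j) = l - (j - x)" by simp
          then show "g dvd x + (r + 1) - (r - l + 1 + j)" using j(3) gl by (metis dvd_diff)
        qed
        finally show ?thesis by simp
      qed
      have shift': "\<phi> (x + (m - r - 1)) = \<phi> x" for x
        using shift[of "x + (m - r - 1)"] m[of x] by (simp add: algebra_simps)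
      define p where "p = gcd g (m - r - 1)"
      have "p \<le> m - r - 1" unfolding p_def using bounds by (intro zdvd_imp_le) auto
      moreover have "p > 0" "p dvd g" using gpos by (auto simp: p_def)
      moreover have "p \<le> g" using \<open>p dvd g\<close> gpos by (intro zdvd_imp_le)
      moreover have "\<phi> (x + p) = \<phi> x" for x unfolding p_def using period_gcd[of \<phi> g "m - r - 1"] g shift' by blast
      moreover have "p dvd l" using \<open>p dvd g\<close> gl(1) by (rule dvd_trans)
      ultimately show ?thesis using gle lm 2 by (intro that[of p]) auto
    qed
  qed
  \<comment> \<open>Paths that come down to \<open>0\<close> and go up from \<open>r\<close> reflect
    in \<open>(r - 1) / 2\<close>; in \<open>b\<close>, those that come up to \<open>0\<close> and
    go down from \<open>r\<close> reflect in \<open>(r + 1) / 2\<close>. The two reflections compose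
    to a translation by 2.\<close>
  have a: "\<phi> x = \<phi> (r - 1 - x)" for x
  proof -
    obtain j where j: "max 0 (l + r - m) \<le> j" "j < max 0 (l + r - m) + p" "p dvd j - x"
      using residue_in_interval[OF p(1), of "max 0 (l + r - m)" x] by auto
    have "\<phi> x = \<phi> j" using j(3) by (intro period_mult[where \<phi> = \<phi>, OF p(7)])
    also have "\<dots> = \<phi> (r + l - 1 - j)" using j p bounds by (intro refl1) auto
    also have "\<dots> = \<phi> (r - 1 - x)"
    proof (rule period_mult[where \<phi> = \<phi>, OF p(7)])
      have "r - 1 - x - (r + l - 1 - j) = (j - x) - l" by simp
      then show "p dvd r - 1 - x - (r + l - 1 - j)" using j(3) p(6) by (metis dvd_diff)
    qed
    finally show ?thesis .
  qed
  have b: "\<phi> x = \<phi> (r + 1 - x)" for x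
  proof -
    obtain j where j: "max 0 (l - r) \<le> j" "j < max 0 (l - r) + p" "p dvd j - (- x)"
      using residue_in_interval[OF p(1), of "max 0 (l - r)" "- x"] by auto
    have "\<phi> x = \<phi> (- j)"
    proof (rule period_mult[where \<phi> = \<phi>, OF p(7)])
      have "- j - x = - (j - (- x))" by simp
      then show "p dvd - j - x" using j(3) dvd_minus_iff by metis
    qed
    also have "\<dots> = \<phi> (r - (l - 1 - j))" using j p bounds by (intro refl2) auto
    also have "\<dots> = \<phi> (r + 1 - x)"
    proof (rule period_mult[where \<phi> = \<phi>, OF p(7)])
      have "r + 1 - x - (r - (l - 1 - j)) = l - (j - (- x))" by simp
      then show "p dvd r + 1 - x - (r - (l - 1 - j))" using j(3) p(6) by (metis dvd_diff)
    qed
    finally show ?thesis .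
  qed
  show ?thesis using a[of x] b[of "x + 2"] by (simp add: algebra_simps)
qed

text \<open>Otherwise membership in \<open>W\<close> would be a colouring that all paths of length
  \<open>l\<close> preserve, and \<open>periodic_two\<close> would make it constant on
  \<open>S\<close>, that is, on the vertices of one parity, against \<open>w\<close> and
  \<open>w'\<close>.\<close>

lemma theta_path:
  assumes sym: "\<And>x y. E x y \<Longrightarrow> E y x" and bip: "\<And>x y. E x y \<Longrightarrow> x \<in> S \<longleftrightarrow> y \<notin> S"
    and th: "theta E k c" and l: "even l" "0 < l" "l < length c"
    and w: "w \<in> set c \<inter> S" "w \<in> W" and w': "w' \<in> set c \<inter> S" "w' \<notin> W"
  shows "\<exists>xs. distinct xs \<and> successively E xs \<and> length xs = Suc l \<and> set xs \<subseteq> set c \<and>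
           hd xs \<in> S \<inter> W \<and> last xs \<in> S - W"
proof (rule ccontr)
  assume neg: "\<not> ?thesis"
  define m where "m = int (length c)"
  define C where "C x = c ! nat (x mod m)" for x
  define \<phi> where "\<phi> x \<longleftrightarrow> C x \<in> S \<inter> W" for x
  from th obtain r0 where c: "distinct c" "successively E c" "E (last c) (hd c)"
    and r0: "2 \<le> r0" "r0 + 2 \<le> length c" "E (hd c) (c ! r0)"
    by (auto simp: theta_def)
  define r where "r = int r0"
  have mpos: "m > 0" using l(3) unfolding m_def by linarith
  have cne: "c \<noteq> []" using l(3) by (cases c) simp_all
  have idx: "nat (x mod m) < length c" for x
    using mpos pos_mod_bound[of m x] pos_mod_sign[of m x] by (simp add: m_def nat_less_iff)
  have Cc: "C x \<in> set c" for x using idx by (simp add: C_def)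
  have Cnat: "C (int i) = c ! i" if "i < length c" for i
    using that by (simp add: C_def m_def)
  have Cm: "C (x + m) = C x" for x by (simp add: C_def)
  have Cinj: "x mod m = y mod m" if "C x = C y" for x y
  proof -
    have "nat (x mod m) = nat (y mod m)" using that idx c(1) by (simp add: C_def nth_eq_iff_index_eq)
    then show ?thesis using mpos by (metis int_nat_eq pos_mod_sign)
  qed
  have adj: "E (C x) (C (x + 1))" for x
  proof (cases "x mod m = m - 1")
    case True
    then have "(x + 1) mod m = 0" using mod_add_left_eq[of x m 1] by simp
    moreover have "nat (m - 1) = length c - 1" unfolding m_def by arith
    then have "c ! nat (m - 1) = last c" using cne by (simp add: last_conv_nth)
    ultimately show ?thesis using c(3) cne True by (simp add: C_def hd_conv_nth)
  next
    case False
    then have "x mod m + 1 < m" using mpos pos_mod_bound[of m x] by linarith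
    then have "(x + 1) mod m = x mod m + 1"
      using mod_add_left_eq[of x m 1] mpos by (simp add: mod_pos_pos_trivial)
    moreover have "nat (x mod m + 1) = Suc (nat (x mod m))" using pos_mod_sign[OF mpos, of x] by linarith
    moreover have "Suc (nat (x mod m)) < length c"
      using \<open>x mod m + 1 < m\<close> pos_mod_sign[OF mpos, of x] unfolding m_def by linarith
    ultimately show ?thesis using successively_nth[OF c(2)] by (simp add: C_def)
  qed
  have adj': "E (C x) (C (x - 1))" for x using adj[of "x - 1"] sym by simp
  have chord: "E (C 0) (C r)" using r0 cne Cnat[of 0] Cnat[of r0] by (simp add: r_def hd_conv_nth)
  have Sstep: "C (x + 1) \<in> S \<longleftrightarrow> C x \<notin> S" for x using bip[OF adj[of x]] by blast
  \<comment> \<open>An even \<open>l\<close> puts both ends on the same side of the bipartition. Off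
    \<open>S\<close> both values of \<open>\<phi>\<close> are false; in \<open>S\<close>, different
    values would make the path or its reverse the one that is sought.\<close>
  have arc: "\<phi> (f 0) = \<phi> (f l)"
    if inj: "\<And>s t. s \<le> l \<Longrightarrow> t \<le> l \<Longrightarrow> f s mod m = f t mod m \<Longrightarrow> s = t"
      and ad: "\<And>t. t < l \<Longrightarrow> E (C (f t)) (C (f (Suc t)))" for f :: "nat \<Rightarrow> int"
  proof -
    define xs where "xs = map (\<lambda>t. C (f t)) [0..<Suc l]"
    have len: "length xs = Suc l" by (simp add: xs_def)
    have nth: "xs ! i = C (f i)" if "i \<le> l" for i using that by (simp add: xs_def del: upt_Suc)
    have d: "distinct xs"
      unfolding distinct_conv_nth
    proof (intro allI impI)
      fix i j assume *: "i < length xs" "j < length xs" "i \<noteq> j"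
      then have "f i mod m \<noteq> f j mod m" using inj[of i j] by (auto simp: len)
      then show "xs ! i \<noteq> xs ! j" using Cinj[of "f i" "f j"] nth[of i] nth[of j] * len by auto
    qed
    have s: "successively E xs"
      unfolding successively_conv_nth
    proof (intro allI impI)
      fix i assume "Suc i < length xs"
      then show "E (xs ! i) (xs ! Suc i)" using nth[of i] nth[of "Suc i"] ad[of i] len by auto
    qed
    have sub: "set xs \<subseteq> set c" using Cc by (auto simp: xs_def)
    have h: "hd xs = C (f 0)" "last xs = C (f l)"
      using nth[of 0] nth[of l] len by (auto simp: hd_conv_nth last_conv_nth simp flip: length_0_conv)
    have par: "C (f t) \<in> S \<longleftrightarrow> (C (f 0) \<in> S \<longleftrightarrow> even t)" if "t \<le> l" for t
      using that
    proof (induction t)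
      case (Suc t)
      then show ?case using bip[OF ad[of t]] by auto
    qed simp
    have SS: "C (f l) \<in> S \<longleftrightarrow> C (f 0) \<in> S" using par[of l] l by auto
    have s': "successively E (rev xs)" using s by (auto intro: successively_mono sym)
    show ?thesis
    proof (rule ccontr)
      assume "\<phi> (f 0) \<noteq> \<phi> (f l)"
      then consider "\<phi> (f 0)" "C (f l) \<in> S - W" | "\<phi> (f l)" "C (f 0) \<in> S - W"
        using SS by (auto simp: \<phi>_def)
      then show False
      proof cases
        case 1
        then show ?thesis using neg[unfolded not_ex, THEN spec, of xs] d s len sub h by (simp add: \<phi>_def)
      next
        case 2
        have "hd (rev xs) = C (f l)" "last (rev xs) = C (f 0)" using h len by (auto simp: hd_rev last_rev)
        moreover have "distinct (rev xs)" "length (rev xs) = Suc l" "set (rev xs) \<subseteq> set c"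
          using d len sub by auto
        ultimately show ?thesis using neg[unfolded not_ex, THEN spec, of "rev xs"] s' 2 by (simp add: \<phi>_def)
      qed
    qed
  qed
  have near: "x = y" if "x mod m = y mod m" "\<bar>x - y\<bar> < m" for x y
  proof (rule ccontr)
    assume "x \<noteq> y"
    moreover have "m dvd x - y" using that(1) by (simp add: mod_eq_dvd_iff)
    ultimately have "\<bar>m\<bar> \<le> \<bar>x - y\<bar>" by (intro dvd_imp_le_int) auto
    then show False using that(2) mpos by simp
  qed
  \<comment> \<open>The path takes \<open>j\<close> steps along the cycle to \<open>0\<close>,
    crosses the chord to \<open>r\<close> and takes the remaining \<open>l - 1 - j\<close> steps
    from there; \<open>\<sigma>\<close> and \<open>\<tau>\<close> are the directions before and
    after the chord. The four sign patterns yield the last four hypotheses of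
    \<open>periodic_two\<close>.\<close>
  have chord_arc: "\<phi> (- (\<sigma> * j)) = \<phi> (r + \<tau> * (int l - 1 - j))"
    if st: "\<sigma> = 1 \<or> \<sigma> = -1" "\<tau> = 1 \<or> \<tau> = -1" and j: "0 \<le> j" "j < int l"
      and ne: "\<And>s t. 0 \<le> s \<Longrightarrow> s \<le> j \<Longrightarrow> 0 \<le> t \<Longrightarrow> t \<le> int l - 1 - j \<Longrightarrow>
        - (\<sigma> * s) \<noteq> r + \<tau> * t \<and> \<bar>- (\<sigma> * s) - (r + \<tau> * t)\<bar> < m" for \<sigma> \<tau> j
  proof -
    have ne: "(- (\<sigma> * s)) mod m \<noteq> (r + \<tau> * t) mod m"
      if "0 \<le> s" "s \<le> j" "0 \<le> t" "t \<le> int l - 1 - j" for s t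
      using ne[OF that] near by blast
    define f where "f t = (if int t \<le> j then - (\<sigma> * (j - int t)) else r + \<tau> * (int t - j - 1))" for t
    have lm: "int l < m" using l by (simp add: m_def)
    have "\<phi> (f 0) = \<phi> (f l)"
    proof (rule arc)
      fix s t assume *: "s \<le> l" "t \<le> l" "f s mod m = f t mod m"
      consider "int s \<le> j" "int t \<le> j" | "int s \<le> j" "\<not> int t \<le> j" | "\<not> int s \<le> j" "int t \<le> j"
        | "\<not> int s \<le> j" "\<not> int t \<le> j" by blast
      then show "s = t"
      proof cases
        case 1
        then have "\<bar>f s - f t\<bar> < m" using j lm st by (auto simp: f_def abs_less_iff)
        then have "f s = f t" using near[OF *(3)] by simp
        then show ?thesis using 1 st by (auto simp: f_def)
      next
        case 2
        then have "f s = - (\<sigma> * (j - int s))" "f t = r + \<tau> * (int t - j - 1)" by (simp_all add: f_def)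
        moreover have "0 \<le> j - int s" "j - int s \<le> j" "0 \<le> int t - j - 1" "int t - j - 1 \<le> int l - 1 - j"
          using 2 * by linarith+
        ultimately show ?thesis using ne[of "j - int s" "int t - j - 1"] *(3) by metis
      next
        case 3
        then have "f t = - (\<sigma> * (j - int t))" "f s = r + \<tau> * (int s - j - 1)" by (simp_all add: f_def)
        moreover have "0 \<le> j - int t" "j - int t \<le> j" "0 \<le> int s - j - 1" "int s - j - 1 \<le> int l - 1 - j"
          using 3 * by linarith+
        ultimately show ?thesis using ne[of "j - int t" "int s - j - 1"] *(3) by metis
      next
        case 4
        then have "\<bar>f s - f t\<bar> < m" using j lm st * by (auto simp: f_def abs_less_iff)
        then have "f s = f t" using near[OF *(3)] by simp
        then show ?thesis using 4 st by (auto simp: f_def)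
      qed
    next
      fix t assume "t < l"
      consider "int t < j" | "int t = j" | "int t > j" by linarith
      then show "E (C (f t)) (C (f (Suc t)))"
      proof cases
        case 1
        then have "f (Suc t) = f t + \<sigma>" by (auto simp: f_def algebra_simps)
        then show ?thesis using adj adj' st by (metis diff_conv_add_uminus)
      next
        case 2
        then show ?thesis using chord by (auto simp: f_def)
      next
        case 3
        then have "f (Suc t) = f t + \<tau>" by (auto simp: f_def algebra_simps)
        then show ?thesis using adj adj' st by (metis diff_conv_add_uminus)
      qed
    qed
    then show ?thesis using j by (simp add: f_def algebra_simps)
  qed
  have bnd: "2 \<le> r" "r + 2 \<le> m" "0 < int l" "int l < m" using r0 l by (auto simp: r_def m_def)
  have "\<phi> (x + 2) = \<phi> x" for x
  proof (rule periodic_two[of \<phi> m "int l" r])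
    show "\<phi> (x + m) = \<phi> x" for x by (simp add: \<phi>_def Cm)
    show "\<phi> (x + int l) = \<phi> x" for x
    proof -
      have "\<phi> (x + int 0) = \<phi> (x + int l)"
      proof (rule arc)
        fix s t assume "s \<le> l" "t \<le> l" "(x + int s) mod m = (x + int t) mod m"
        then show "s = t" using near[of "x + int s" "x + int t"] bnd by auto
      next
        show "E (C (x + int t)) (C (x + int (Suc t)))" for t
          using adj[of "x + int t"] by (simp add: algebra_simps)
      qed
      then show ?thesis by simp
    qed
    show "\<phi> (- j) = \<phi> (r + int l - 1 - j)" if "int l \<le> m - r" "0 \<le> j" "j < int l" for j
    proof -
      have "\<phi> (- (1 * j)) = \<phi> (r + 1 * (int l - 1 - j))"
        using that bnd by (intro chord_arc) (auto simp: abs_less_iff)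
      then show ?thesis by (simp add: algebra_simps)
    qed
    show "\<phi> j = \<phi> (r - int l + 1 + j)" if "int l \<le> r" "0 \<le> j" "j < int l" for j
    proof -
      have "\<phi> (- ((-1) * j)) = \<phi> (r + (-1) * (int l - 1 - j))"
        using that bnd by (intro chord_arc) (auto simp: abs_less_iff)
      then show ?thesis by (simp add: algebra_simps)
    qed
    show "\<phi> j = \<phi> (r + int l - 1 - j)" if "0 \<le> j" "j < r" "j < int l" "r + int l - 1 - j < m" for j
    proof -
      have "\<phi> (- ((-1) * j)) = \<phi> (r + 1 * (int l - 1 - j))"
        using that bnd by (intro chord_arc) (auto simp: abs_less_iff)
      then show ?thesis by (simp add: algebra_simps)
    qed
    show "\<phi> (- j) = \<phi> (r - (int l - 1 - j))" if "0 \<le> j" "j < m - r" "j < int l" "r - (int l - 1 - j) > 0" for j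
    proof -
      have "\<phi> (- (1 * j)) = \<phi> (r + (-1) * (int l - 1 - j))"
        using that bnd by (intro chord_arc) (auto simp: abs_less_iff)
      then show ?thesis by (simp add: algebra_simps)
    qed
  qed (use bnd in auto)
  note per = this
  obtain a b where ab: "a < length c" "c ! a = w" "b < length c" "c ! b = w'"
    using w(1) w'(1) by (auto simp: in_set_conv_nth)
  have par: "C (x + int t) \<in> S \<longleftrightarrow> (C x \<in> S \<longleftrightarrow> even t)" for x t
  proof (induction t)
    case (Suc t)
    have "x + int (Suc t) = (x + int t) + 1" by simp
    then have "C (x + int (Suc t)) \<in> S \<longleftrightarrow> C (x + int t) \<notin> S" by (simp only: Sstep)
    then show ?case using Suc by auto
  qed simp
  have pos: "\<phi> (int a)" "\<not> \<phi> (int b)" "C (int a) \<in> S" "C (int b) \<in> S"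
    using ab w w' Cnat[of a] Cnat[of b] by (simp_all add: \<phi>_def)
  have "even (int b - int a)"
  proof (cases "a \<le> b")
    case True
    then have "int a + int (b - a) = int b" by simp
    then have "even (b - a)" using par[of "int a" "b - a"] pos(3,4) by simp
    then show ?thesis using True by simp
  next
    case False
    then have "int b + int (a - b) = int a" by simp
    then have "even (a - b)" using par[of "int b" "a - b"] pos(3,4) by simp
    then show ?thesis using False by simp
  qed
  then have "\<phi> (int a) = \<phi> (int b)" by (intro period_mult[where \<phi> = \<phi>, OF per])
  with pos show False by simp
qed

section \<open>Theta graphs\<close>

lemma nth_image_segment:
  assumes "a \<le> c" "c < length P"
  shows "set (take (Suc c - a) (drop a P)) = (!) P ` {a..c}"
proof -
  have "set (take (Suc c - a) (drop a P)) = (!) (drop a P) ` {0..<Suc c - a}"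
    using assms by (intro nth_image[symmetric]) auto
  also have "\<dots> = (\<lambda>i. P ! (a + i)) ` {0..<Suc c - a}"
    using assms by (intro image_cong) auto
  also have "\<dots> = (!) P ` ((+) a ` {0..<Suc c - a})" by (simp only: image_image)
  also have "(+) a ` {0..<Suc c - a} = {a..c}"
    using assms by (auto simp: atLeastLessThanSuc_atLeastAtMost)
  finally show ?thesis .
qed

text \<open>The chord may start at either end of the closing edge. In the second case the segment is
  reversed, which brings that end to the head, where \<open>theta\<close> expects it.\<close>

lemma theta_segment:
  assumes sym: "\<And>x y. E x y \<Longrightarrow> E y x"
    and P: "distinct P" "successively E P" and ac: "a < c" "c < length P" "2 * k \<le> Suc c - a"
    and e: "E (P ! a) (P ! c)" and b: "a < b" "b < c"
    and chord: "E (P ! a) (P ! b) \<and> b \<noteq> Suc a \<or> E (P ! b) (P ! c) \<and> Suc b \<noteq> c"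
  shows "\<exists>c'. theta E k c' \<and> set c' = (!) P ` {a..c}"
proof -
  define Q where "Q = take (Suc c - a) (drop a P)"
  have len: "length Q = Suc c - a" using ac by (simp add: Q_def)
  have nth: "Q ! i = P ! (a + i)" if "i < Suc c - a" for i using that ac by (simp add: Q_def)
  have "P = take a P @ Q @ drop (Suc c) P"
    using ac by (simp add: Q_def) (metis append_take_drop_id drop_drop le_add_diff_inverse2 less_Suc_eq less_or_eq_imp_le)
  then have Q: "distinct Q" "successively E Q"
    using P by (metis distinct_append, metis successively_append_iff)
  have Q': "successively E (rev Q)" using Q by (auto intro: successively_mono sym)
  have ne: "Q \<noteq> []" using len ac by auto
  have h: "hd Q = P ! a" "last Q = P ! c"
    using nth[of 0] nth[of "c - a"] len ac ne by (auto simp: hd_conv_nth last_conv_nth Suc_diff_le)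
  have set: "set Q = (!) P ` {a..c}" unfolding Q_def using ac by (intro nth_image_segment) auto
  from chord show ?thesis
  proof
    assume "E (P ! a) (P ! b) \<and> b \<noteq> Suc a"
    then have "theta E k Q" unfolding theta_def
      using Q len h ac b sym[OF e] nth[of "b - a"] by (auto intro!: exI[of _ "b - a"])
    then show ?thesis using set by blast
  next
    assume *: "E (P ! b) (P ! c) \<and> Suc b \<noteq> c"
    have "rev Q ! (c - b) = P ! b"
      using len nth[of "b - a"] b ac by (simp add: rev_nth)
    then have "theta E k (rev Q)" unfolding theta_def
      using Q Q' len h ac b e sym * ne by (auto simp: hd_rev last_rev intro!: exI[of _ "c - b"])
    then show ?thesis using set by (metis set_rev)
  qed
qed

lemma path_parity:
  assumes bip: "\<And>x y. E x y \<Longrightarrow> x \<in> S \<longleftrightarrow> y \<notin> S" and P: "successively E P"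
    and "i \<le> j" "j < length P"
  shows "P ! j \<in> S \<longleftrightarrow> (P ! i \<in> S \<longleftrightarrow> even (j - i))"
  using assms(3,4)
proof (induction j rule: dec_induct)
  case (step n)
  then show ?case using bip[OF successively_nth[OF P, of n]] by (auto simp: Suc_diff_le)
qed simp

text \<open>By bipartiteness the neighbours of the last vertex sit at odd distances from it along
  the path, so more than \<open>k\<close> of them reach back at least \<open>2 * k - 1\<close>
  steps. The farthest one closes the cycle and another one gives the chord; \<open>k \<ge> 2\<close>
  leaves one that is not the predecessor of the end on the path.\<close>

lemma theta_many_nbrs:
  assumes sym: "\<And>x y. E x y \<Longrightarrow> E y x" and bip: "\<And>x y. E x y \<Longrightarrow> x \<in> S \<longleftrightarrow> y \<notin> S"
    and P: "distinct P" "successively E P" and k: "k \<ge> 2"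
    and many: "k < card {y \<in> set P. E (last P) y}"
  shows "\<exists>c. theta E k c \<and> set c \<subseteq> set P"
proof -
  have ne: "P \<noteq> []" using many by auto
  define n where "n = length P - 1"
  have n: "n < length P" "last P = P ! n" using ne by (auto simp: n_def last_conv_nth)
  define J where "J = {j. j < length P \<and> E (P ! n) (P ! j)}"
  have fin: "finite J" by (simp add: J_def)
  have "{y \<in> set P. E (last P) y} = (!) P ` J" using n by (auto simp: J_def in_set_conv_nth)
  then have cardJ: "k < card J" using many card_image_le[OF fin, of "(!) P"] by simp
  have odd: "odd (n - j)" if "j \<in> J" for j
    using path_parity[OF bip P(2), of j n] bip[of "P ! n" "P ! j"] that n by (auto simp: J_def n_def)
  have lt: "j < n" if "j \<in> J" for j using odd[OF that] by (metis even_zero not_less diff_is_0_eq)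
  have Jne: "J \<noteq> {}" using cardJ by auto
  define a where "a = Min J"
  have a: "a \<in> J" "\<And>j. j \<in> J \<Longrightarrow> a \<le> j" using fin Jne by (auto simp: a_def)
  have far: "2 * k \<le> Suc n - a"
  proof (rule ccontr)
    assume "\<not> ?thesis"
    then have "(\<lambda>j. (n - j) div 2) ` J \<subseteq> {..<k}" using a(2) by fastforce
    moreover have "inj_on (\<lambda>j. (n - j) div 2) J"
    proof (rule inj_onI)
      fix i j assume *: "i \<in> J" "j \<in> J" "(n - i) div 2 = (n - j) div 2"
      then have "n - i = n - j" using odd by (metis odd_two_times_div_two_succ)
      then show "i = j" using lt * by (metis diff_diff_cancel less_imp_le)
    qed
    ultimately have "card J \<le> k" using card_inj_on_le[of _ J "{..<k}"] by fastforce
    then show False using cardJ by simp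
  qed
  have "card {a, n - 1} \<le> 2" by (simp add: card_insert_if)
  then have "\<not> J \<subseteq> {a, n - 1}" using cardJ k card_mono[of "{a, n - 1}" J] by auto
  then obtain b where b: "b \<in> J" "b \<noteq> a" "b \<noteq> n - 1" by auto
  have ab: "a < b" "b < n" using a(2) b lt by (auto simp: le_neq_implies_less)
  have "Suc b \<noteq> n" using b by auto
  moreover have "E (P ! a) (P ! n)" "E (P ! b) (P ! n)" using a(1) b(1) sym by (auto simp: J_def)
  ultimately obtain c where "theta E k c" "set c = (!) P ` {a..n}"
    using ab far n theta_segment[OF sym P, of a n k b] by fastforce
  moreover have "(!) P ` {a..n} \<subseteq> set P" using n by auto
  ultimately have "theta E k c \<and> set c \<subseteq> set P" by simp
  then show ?thesis ..
qed

section \<open>Closing up a path through the upper layers\<close>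

lemma successively_map_upt:
  assumes "\<And>i. a \<le> i \<Longrightarrow> Suc i < b \<Longrightarrow> R (f i) (f (Suc i))"
  shows "successively R (map f [a..<b])"
  using assms by (auto simp: successively_conv_nth)

text \<open>The cycle consists of a path of length \<open>2 * k - 2 * h\<close> in the theta graph and of two branches of
  length \<open>h\<close> that lead upwards from its ends until they meet for the first time.\<close>

lemma theta_in_layers_cycle:
  fixes L :: "nat \<Rightarrow> 'a set"
  assumes sym: "\<And>x y. E x y \<Longrightarrow> E y x" and bip: "\<And>x y. E x y \<Longrightarrow> x \<in> S \<longleftrightarrow> y \<notin> S"
    and k: "k \<ge> 2" and th: "theta E k c" and i: "1 \<le> i" "i < k"
    and L0: "L 0 = {x0}" and disj: "\<And>j j'. j \<noteq> j' \<Longrightarrow> L j \<inter> L j' = {}"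
    and down: "\<And>j v. v \<in> L (Suc j) \<Longrightarrow> \<exists>u\<in>L j. E u v"
    and LS: "\<And>j v. v \<in> L j \<Longrightarrow> v \<in> S \<longleftrightarrow> even j"
    and c: "set c \<subseteq> L (i - 1) \<union> L i \<union> L (Suc i)"
    and wp: "\<And>v. v \<in> set c \<inter> L i \<Longrightarrow> \<exists>u\<in>L (i - 1) - set c. E u v"
  shows "\<exists>xs. length xs = 2 * k \<and> distinct xs \<and> successively E xs \<and> E (last xs) (hd xs)"
proof -
  \<comment> \<open>Normalised so that \<open>L i\<close> lies in \<open>S'\<close>, whatever the
    parity of \<open>i\<close>.\<close>
  define S' where "S' = (if even i then S else - S)"
  have bip': "x \<in> S' \<longleftrightarrow> y \<notin> S'" if "E x y" for x y using bip[OF that] by (auto simp: S'_def)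
  have LS': "v \<in> S' \<longleftrightarrow> even (i + j)" if "v \<in> L j" for v j using LS[OF that] by (auto simp: S'_def)
  have cS: "v \<in> L i \<longleftrightarrow> v \<in> S'" if "v \<in> set c" for v
  proof
    show "v \<in> L i \<Longrightarrow> v \<in> S'" using LS'[of v i] by simp
    assume "v \<in> S'"
    moreover have "v \<in> L (i - 1) \<or> v \<in> L i \<or> v \<in> L (Suc i)" using c that by auto
    moreover have "odd (i + (i - 1))" "odd (i + Suc i)" using i by auto
    ultimately show "v \<in> L i" using LS' by blast
  qed
  have clen: "2 * k \<le> length c" and cd: "distinct c" and cs: "successively E c"
    using th by (auto simp: theta_def)
  have uniq: "j = j'" if "v \<in> L j" "v \<in> L j'" for v j j' using disj[of j j'] that by blast
  \<comment> \<open>Each vertex chooses one parent, so that branches that have met stay together.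
    For a vertex of the theta graph in \<open>L i\<close> the parent is taken off the theta graph;
    the higher ancestors lie above the three layers anyway.\<close>
  have "\<forall>v. \<exists>u. (\<forall>j. v \<in> L (Suc j) \<longrightarrow> u \<in> L j \<and> E u v) \<and> (v \<in> set c \<inter> L i \<longrightarrow> u \<notin> set c)"
  proof
    fix v
    show "\<exists>u. (\<forall>j. v \<in> L (Suc j) \<longrightarrow> u \<in> L j \<and> E u v) \<and> (v \<in> set c \<inter> L i \<longrightarrow> u \<notin> set c)"
    proof (cases "v \<in> set c \<inter> L i")
      case True
      then obtain u where u: "u \<in> L (i - 1) - set c" "E u v" using wp by blast
      have "u \<in> L j \<and> E u v" if "v \<in> L (Suc j)" for j using uniq[OF that, of i] True u by auto
      then show ?thesis using u by blast
    next
      case False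
      show ?thesis
      proof (cases "\<exists>j. v \<in> L (Suc j)")
        case True
        then obtain j u where u: "v \<in> L (Suc j)" "u \<in> L j" "E u v" using down by blast
        have "u \<in> L j' \<and> E u v" if "v \<in> L (Suc j')" for j' using uniq[OF that u(1)] u by simp
        then show ?thesis using False by blast
      qed (use False in auto)
    qed
  qed
  then obtain p where p: "\<And>v j. v \<in> L (Suc j) \<Longrightarrow> p v \<in> L j \<and> E (p v) v"
    and pc: "\<And>v. v \<in> set c \<inter> L i \<Longrightarrow> p v \<notin> set c"
    by metis
  define q where "q t v = (p ^^ t) v" for t v
  define F where "F = set c \<inter> L i"
  have q0: "q 0 v = v" for v by (simp add: q_def)
  have qS: "q (Suc t) v = p (q t v)" for t v by (simp add: q_def)
  have qL: "q t v \<in> L (i - t)" if "v \<in> F" "t \<le> i" for t v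
    using that(2)
  proof (induction t)
    case 0
    then show ?case using that by (simp add: q0 F_def)
  next
    case (Suc t)
    then have "q t v \<in> L (Suc (i - Suc t))" by (simp add: Suc_diff_Suc)
    then show ?case using p by (simp add: qS)
  qed
  have qE: "E (q (Suc t) v) (q t v)" if "v \<in> F" "Suc t \<le> i" for t v
  proof -
    have "q t v \<in> L (Suc (i - Suc t))" using qL[of v t] that by (simp add: Suc_diff_Suc)
    then show ?thesis using p by (simp add: qS)
  qed
  have qc: "q t v \<notin> set c" if "v \<in> F" "1 \<le> t" "t \<le> i" for t v
  proof (cases "t = 1")
    case True
    then show ?thesis using pc that qS[of 0] by (simp add: F_def q0)
  next
    case False
    have "q t v \<in> L (i - t)" using qL that by auto
    then show ?thesis using c uniq[of "q t v" "i - t"] that False by fastforce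
  qed
  have "\<exists>a b. a \<in> F \<and> b \<in> F \<and> a \<noteq> b"
  proof -
    have l4: "4 \<le> length c" using clen k by simp
    have "c ! 0 \<in> S' \<or> c ! 1 \<in> S'" using bip'[OF successively_nth[OF cs, of 0]] l4 by auto
    then obtain j where j: "j \<le> 1" "c ! j \<in> S'" by auto
    then have "c ! (j + 2) \<in> S'"
      using path_parity[where E = E and S = S' and P = c and i = j and j = "j + 2"] bip' cs l4 by auto
    moreover have "c ! j \<noteq> c ! (j + 2)" using cd l4 j by (simp add: nth_eq_iff_index_eq)
    ultimately show ?thesis using j l4 cS by (intro exI[of _ "c ! j"] exI[of _ "c ! (j + 2)"]) (auto simp: F_def)
  qed
  then obtain v1 v2 where v12: "v1 \<in> F" "v2 \<in> F" "v1 \<noteq> v2" by blast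
  \<comment> \<open>Whether all branches have met after \<open>h\<close> steps, as they do in the
    root at the latest. One step before the first such \<open>h\<close> the branches still fall into
    at least two classes, and one class serves as \<open>W\<close>.\<close>
  define same where "same h \<longleftrightarrow> (\<forall>a\<in>F. \<forall>b\<in>F. q h a = q h b)" for h
  have "same i" unfolding same_def using qL[of _ i] L0 by (metis diff_self_eq_0 order_refl singletonD)
  define h where "h = (LEAST h. same h)"
  have h: "same h" "h \<le> i" "\<And>h'. h' < h \<Longrightarrow> \<not> same h'"
    unfolding h_def by (rule LeastI[of same, OF \<open>same i\<close>], rule Least_le[of same, OF \<open>same i\<close>], rule not_less_Least)
  have "h \<noteq> 0"
  proof
    assume "h = 0"
    then have "q 0 v1 = q 0 v2" using h(1) v12 unfolding same_def by blast
    then show False using v12 by (simp add: q0)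
  qed
  then obtain h' where h': "h = Suc h'" by (cases h) auto
  then obtain v0 w0 where vw0: "v0 \<in> F" "w0 \<in> F" "q h' v0 \<noteq> q h' w0" using h(3)[of h'] unfolding same_def by blast
  define W where "W = {v. q h' v = q h' v0}"
  \<comment> \<open>The branches take up \<open>2 * h\<close> of the \<open>2 * k\<close> edges.
    From \<open>1 \<le> h\<close> and \<open>h \<le> i < k\<close> it follows that \<open>l\<close>
    is positive and smaller than the length of the cycle \<open>c\<close>.\<close>
  define l where "l = 2 * k - 2 * h"
  have FS: "F = set c \<inter> S'" using cS by (auto simp: F_def)
  have "\<exists>xs. distinct xs \<and> successively E xs \<and> length xs = Suc l \<and> set xs \<subseteq> set c \<and>
           hd xs \<in> S' \<inter> W \<and> last xs \<in> S' - W"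
    using vw0 h i clen \<open>h \<noteq> 0\<close>
    by (intro theta_path[OF sym bip' th, of l v0 W w0]) (auto simp: l_def W_def FS)
  then obtain xs where xs: "distinct xs" "successively E xs" "length xs = Suc l" "set xs \<subseteq> set c"
    "hd xs \<in> S' \<inter> W" "last xs \<in> S' - W" by blast
  have xne: "xs \<noteq> []" using xs(3) by auto
  define v where "v = hd xs"
  define w where "w = last xs"
  have vF: "v \<in> F" and wF: "w \<in> F" using xs xne FS by (auto simp: v_def w_def)
  have qne: "q t v \<noteq> q t w" if "t \<le> h'" for t
  proof
    assume "q t v = q t w"
    then have "q (t + s) v = q (t + s) w" for s by (induction s) (auto simp: qS)
    from this[of "h' - t"] have "q h' v = q h' w" using that by simp
    then show False using xs by (auto simp: v_def w_def W_def)
  qed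
  have qh: "q h v = q h w" using h(1) vF wF unfolding same_def by blast
  \<comment> \<open>\<open>A\<close> includes the meeting point \<open>q h w\<close>,
    \<open>B\<close> stops one vertex before it. Since the ends of \<open>xs\<close> are in
    different classes after \<open>h'\<close> steps, the branches meet after \<open>h\<close> steps
    and not earlier.\<close>
  define A where "A = map (\<lambda>t. q t w) [1..<Suc h]"
  define B where "B = map (\<lambda>t. q t v) [1..<h]"
  have qinj: "s = t" if "q s a = q t b" "a \<in> F" "b \<in> F" "s \<le> i" "t \<le> i" for s t a b
    using uniq[of "q s a" "i - s" "i - t"] qL[of a s] qL[of b t] that by auto
  have "distinct A" "distinct B"
    unfolding A_def B_def distinct_map using h(2) vF wF qinj by (auto intro!: inj_onI)
  moreover have "set A \<inter> set B = {}"
  proof (rule ccontr)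
    assume "\<not> ?thesis"
    then obtain z where "z \<in> set A" "z \<in> set B" by blast
    moreover have "set A = (\<lambda>t. q t w) ` {1..h}" "set B = (\<lambda>t. q t v) ` {1..<h}"
      by (simp_all add: A_def B_def atLeastLessThanSuc_atLeastAtMost del: upt_Suc)
    ultimately obtain s t where "z = q s w" "s \<in> {1..h}" "z = q t v" "t \<in> {1..<h}" by (metis imageE)
    then have st: "q s w = q t v" "1 \<le> s" "s \<le> h" "1 \<le> t" "t < h" by simp_all
    then have "s = t" using qinj[of s w t v] vF wF h(2) by auto
    then show False using qne[of t] st h' by auto
  qed
  moreover have "set xs \<inter> set A = {}" "set xs \<inter> set B = {}"
  proof -
    have "x \<notin> set c" if "x \<in> set A" for x using that qc[OF wF] h(2) by (auto simp: A_def simp del: upt_Suc)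
    moreover have "x \<notin> set c" if "x \<in> set B" for x using that qc[OF vF] h(2) by (auto simp: B_def)
    ultimately show "set xs \<inter> set A = {}" "set xs \<inter> set B = {}" using xs(4) by blast+
  qed
  ultimately have dist: "distinct (xs @ A @ rev B)" using xs(1) by auto
  have Ane: "A \<noteq> []" using \<open>h \<noteq> 0\<close> by (simp add: A_def)
  have hA: "hd A = q 1 w" "last A = q h w"
    using \<open>h \<noteq> 0\<close> by (auto simp: A_def hd_map last_map simp del: upt_Suc)
  have sA: "successively E A" unfolding A_def
    using qE[OF wF] sym h(2) by (intro successively_map_upt) auto
  have sB: "successively E (rev B)" unfolding B_def successively_rev
    using qE[OF vF] h(2) by (intro successively_map_upt) auto
  have x1: "E (last xs) (hd A)" using qE[OF wF, of 0] sym h(2) \<open>h \<noteq> 0\<close> by (auto simp: hA q0 w_def[symmetric])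
  have x2: "rev B = [] \<or> E (last A) (hd (rev B)) \<and> last (rev B) = q 1 v"
  proof (cases "h = 1")
    case False
    then have h1: "1 < h" using \<open>h \<noteq> 0\<close> by simp
    then have "hd (rev B) = q h' v" using h' by (simp add: B_def)
    moreover have "last (rev B) = q 1 v" using h1 by (simp add: B_def last_rev hd_map del: upt_Suc)
    ultimately show ?thesis using qE[OF vF, of h'] h(2) h' qh by (auto simp: hA)
  qed (simp add: B_def)
  have s: "successively E (xs @ A @ rev B)"
    using xs(2) sA sB x1 x2 Ane xne by (auto simp: successively_append_iff)
  have "last (xs @ A @ rev B) = q 1 v"
    using x2 hA qh Ane h' by (cases "h = 1") (auto simp: B_def)
  then have e: "E (last (xs @ A @ rev B)) (hd (xs @ A @ rev B))"
    using qE[OF vF, of 0] h(2) \<open>h \<noteq> 0\<close> xne by (simp add: q0 v_def)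
  have "length (xs @ A @ rev B) = 2 * k"
    using xs(3) h(2) i \<open>h \<noteq> 0\<close> by (simp add: A_def B_def l_def)
  then show ?thesis using dist s e by blast
qed

section \<open>Theta graphs in dense and in trilayered graphs\<close>

lemma sum_card_swap:
  assumes "finite A" "finite B"
  shows "(\<Sum>x\<in>A. card {y \<in> B. R x y}) = (\<Sum>y\<in>B. card {x \<in> A. R x y})"
proof -
  have c: "card {y \<in> B. Q y} = (\<Sum>y\<in>B. if Q y then 1 else 0)" if "finite B" for B :: "'c set" and Q
    using that by (simp add: sum.If_cases Int_def)
  show ?thesis using assms by (simp add: c sum.swap[of _ A])
qed

text \<open>A smallest set of average degree above \<open>2 * \<delta>\<close> works: deleting a
  vertex lowers the degree sum by twice its degree, so a vertex of degree at most
  \<open>\<delta>\<close> could be deleted.\<close>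

lemma min_degree_subset:
  fixes \<delta> :: real
  assumes fin: "finite U" and sym: "\<And>x y. E x y \<Longrightarrow> E y x" and irr: "\<And>x. \<not> E x x"
    and dense: "2 * \<delta> * real (card U) < real (\<Sum>x\<in>U. card {y \<in> U. E x y})"
  obtains A where "A \<subseteq> U" "A \<noteq> {}" "\<And>x. x \<in> A \<Longrightarrow> \<delta> < card {y \<in> A. E x y}"
proof -
  define e where "e A = (\<Sum>x\<in>A. card {y \<in> A. E x y})" for A
  define good where "good A \<longleftrightarrow> A \<subseteq> U \<and> 2 * \<delta> * card A < real (e A)" for A
  have "good U" using dense by (simp add: good_def e_def)
  then obtain A where A: "good A" "\<And>B. card B < card A \<Longrightarrow> \<not> good B"
    using ex_has_least_nat[of good U card] by (metis not_less)
  have finA: "finite A" using A(1) fin by (auto simp: good_def intro: finite_subset)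
  have "A \<noteq> {}" using A(1) by (auto simp: good_def e_def)
  moreover have "\<delta> < card {y \<in> A. E v y}" if v: "v \<in> A" for v
  proof -
    define B where "B = A - {v}"
    have B: "finite B" "v \<notin> B" "A = insert v B" using finA v by (auto simp: B_def)
    have "\<not> good B" unfolding B_def by (intro A(2) card_Diff1_less finA v)
    then have eB: "real (e B) \<le> 2 * \<delta> * card B" using A(1) by (auto simp: good_def B_def)
    have deg: "card {y \<in> A. E x y} = card {y \<in> B. E x y} + (if E x v then 1 else 0)" for x
    proof -
      have "{y \<in> A. E x y} = (if E x v then insert v {y \<in> B. E x y} else {y \<in> B. E x y})"
        using B by auto
      then show ?thesis using B by simp
    qed
    have "e A = card {y \<in> A. E v y} + (\<Sum>x\<in>B. card {y \<in> A. E x y})"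
      using B by (simp add: e_def)
    also have "(\<Sum>x\<in>B. card {y \<in> A. E x y}) = e B + card {x \<in> B. E x v}"
      unfolding deg sum.distrib e_def using B(1) by (simp add: sum.If_cases Int_def)
    also have "{x \<in> B. E x v} = {y \<in> A. E v y}" using B sym irr by auto
    finally have "real (e A) = real (e B) + 2 * real (card {y \<in> A. E v y})" by simp
    moreover have "2 * \<delta> * card A < real (e A)" using A(1) by (simp add: good_def)
    moreover have "real (card A) = real (card B) + 1" using B by simp
    ultimately show ?thesis using eB by (simp add: algebra_simps)
  qed
  ultimately show ?thesis using A(1) that[of A] by (auto simp: good_def)
qed

text \<open>The average degree is above \<open>2 * k\<close>, so there is a subgraph of minimum
  degree above \<open>k\<close>. A longest path in it contains all neighbours of its end there, and
  \<open>theta_many_nbrs\<close> applies.\<close>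

lemma theta_dense:
  assumes fin: "finite X" "finite Y" and XY: "X \<inter> Y = {}" and k: "k \<ge> 2"
    and sym: "\<And>x y. E x y \<Longrightarrow> E y x" and bip: "\<And>x y. E x y \<Longrightarrow> x \<in> S \<longleftrightarrow> y \<notin> S"
    and dense: "k * (card X + card Y) < (\<Sum>x\<in>X. card {y \<in> Y. E x y})"
  shows "\<exists>c. theta E k c \<and> set c \<subseteq> X \<union> Y"
proof -
  define E' where "E' x y \<longleftrightarrow> E x y \<and> (x \<in> X \<and> y \<in> Y \<or> x \<in> Y \<and> y \<in> X)" for x y
  have "(\<Sum>x\<in>X \<union> Y. card {y \<in> X \<union> Y. E' x y}) =
      (\<Sum>x\<in>X. card {y \<in> X \<union> Y. E' x y}) + (\<Sum>x\<in>Y. card {y \<in> X \<union> Y. E' x y})"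
    using fin XY by (simp add: sum.union_disjoint)
  also have "(\<Sum>x\<in>X. card {y \<in> X \<union> Y. E' x y}) = (\<Sum>x\<in>X. card {y \<in> Y. E x y})"
    using XY by (intro sum.cong arg_cong[of _ _ card]) (auto simp: E'_def)
  also have "(\<Sum>x\<in>Y. card {y \<in> X \<union> Y. E' x y}) = (\<Sum>x\<in>Y. card {y \<in> X. E y x})"
    using XY sym by (intro sum.cong arg_cong[of _ _ card]) (auto simp: E'_def)
  also have "\<dots> = (\<Sum>x\<in>X. card {y \<in> Y. E x y})" using fin by (rule sum_card_swap[symmetric])
  finally have "2 * k * card (X \<union> Y) < (\<Sum>x\<in>X \<union> Y. card {y \<in> X \<union> Y. E' x y})"
    using dense fin XY by (simp add: card_Un_disjoint)
  then have "real (2 * k * card (X \<union> Y)) < real (\<Sum>x\<in>X \<union> Y. card {y \<in> X \<union> Y. E' x y})"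
    by (simp only: of_nat_less_iff)
  then have d: "2 * real k * real (card (X \<union> Y)) < real (\<Sum>x\<in>X \<union> Y. card {y \<in> X \<union> Y. E' x y})"
    by (simp only: of_nat_mult of_nat_numeral)
  obtain A where A: "A \<subseteq> X \<union> Y" "A \<noteq> {}" "\<And>x. x \<in> A \<Longrightarrow> real k < card {y \<in> A. E' x y}"
  proof (rule min_degree_subset[of "X \<union> Y" E' "real k"])
    show "E' y x" if "E' x y" for x y using that sym by (auto simp: E'_def)
    show "\<not> E' x x" for x using XY by (auto simp: E'_def)
  qed (use d fin in auto)
  define path where "path P \<longleftrightarrow> P \<noteq> [] \<and> distinct P \<and> successively E P \<and> set P \<subseteq> A" for P
  have finA: "finite A" using A(1) fin by (auto intro: finite_subset)
  obtain a where "a \<in> A" using A(2) by auto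
  then have "path [a]" by (simp add: path_def)
  moreover have "length P < Suc (card A)" if "path P" for P
    using that card_mono[OF finA, of "set P"] by (auto simp: path_def distinct_card)
  ultimately obtain P where P: "path P" "\<And>P'. path P' \<Longrightarrow> length P' \<le> length P"
    using ex_has_greatest_nat[of path "[a]" length "Suc (card A)"] by blast
  have last: "last P \<in> A" using P(1) by (auto simp: path_def)
  have "{y \<in> A. E' (last P) y} \<subseteq> {y \<in> set P. E (last P) y}"
  proof (rule subsetI, rule ccontr)
    fix y assume y: "y \<in> {y \<in> A. E' (last P) y}" "y \<notin> {y \<in> set P. E (last P) y}"
    then have "path (P @ [y])" using P(1) by (auto simp: path_def successively_append_iff E'_def)
    then show False using P(2) by fastforce
  qed
  then have "card {y \<in> A. E' (last P) y} \<le> card {y \<in> set P. E (last P) y}" by (intro card_mono) auto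
  then have "k < card {y \<in> set P. E (last P) y}" using A(3)[OF last] by simp
  then obtain c where "theta E k c" "set c \<subseteq> set P"
    using theta_many_nbrs[where E = E and S = S and P = P and k = k] sym bip k P(1) unfolding path_def by blast
  then show ?thesis using P(1) A(1) unfolding path_def by blast
qed

section \<open>Paths that rarely visit the upper layer\<close>

lemma spaced_set:
  fixes J :: "nat set"
  assumes J: "finite J" "J \<noteq> {}" and D: "D > 0" and sp: "\<And>i j. i \<in> J \<Longrightarrow> j \<in> J \<Longrightarrow> i < j \<Longrightarrow> i + D \<le> j"
  shows "Min J + D * (card J - 1) \<le> Max J"
proof -
  define f where "f j = (j - Min J) div D" for j
  have ge: "Min J \<le> j" "j \<le> Max J" if "j \<in> J" for j using that J by auto
  have less: "f i < f j" if "i \<in> J" "j \<in> J" "i < j" for i j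
  proof -
    have "i - Min J + D \<le> j - Min J" using sp[OF that] ge(1)[OF that(1)] by simp
    then have "(i - Min J + D) div D \<le> (j - Min J) div D" by (rule div_le_mono)
    then show ?thesis using D by (simp add: f_def)
  qed
  have "inj_on f J" using less by (intro inj_onI) (metis less_irrefl nat_neq_iff)
  moreover have "f ` J \<subseteq> {..f (Max J)}" using ge by (auto simp: f_def intro!: div_le_mono diff_le_mono)
  ultimately have "card J \<le> Suc (f (Max J))" using card_inj_on_le[of f J "{..f (Max J)}"] by simp
  then have "D * (card J - 1) \<le> D * f (Max J)" by (intro mult_le_mono2) simp
  also have "\<dots> \<le> Max J - Min J" by (simp add: f_def)
  finally have "D * (card J - 1) \<le> Max J - Min J" .
  moreover have "Min J \<le> Max J" using ge(1) Max_in[OF J] by blast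
  ultimately show ?thesis by linarith
qed

text \<open>\<open>X1\<close> is the upper, \<open>X2\<close> the middle and \<open>X3\<close> the
  lower layer. The path returns to \<open>X1\<close> at most once in \<open>2 * T\<close> steps, so
  \<open>q\<close> of its vertices there span \<open>2 * T * (q - 1) \<ge> 2 * k - 2\<close> steps.
  By \<open>2 * q \<le> b\<close>, a vertex with all but one of its \<open>b\<close> neighbours on
  the path has \<open>q\<close> of them on one side. The bound in \<open>deg1\<close> counts what
  can obstruct a step out of \<open>X1\<close>: \<open>2 * k * 5 ^ T\<close> bad vertices and
  \<open>k\<close> neighbours on the path. The degrees into \<open>X3\<close> agree up to a factor
  of 2, which limits how fast bad vertices multiply.\<close>

locale trilayer =
  fixes R :: "'a \<Rightarrow> 'a \<Rightarrow> bool" and X1 X2 X3 :: "'a set" and k b q T s :: nat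
  assumes fin: "finite X1" "finite X2" "finite X3"
    and disj: "X1 \<inter> X2 = {}" "X1 \<inter> X3 = {}" "X2 \<inter> X3 = {}"
    and sym: "R x y \<Longrightarrow> R y x"
    and edge: "R x y \<Longrightarrow> x \<in> X2 \<and> y \<in> X1 \<union> X3 \<or> y \<in> X2 \<and> x \<in> X1 \<union> X3"
    and deg1: "u \<in> X1 \<Longrightarrow> 2 * k * 5 ^ T + k < card {w. R u w}"
    and deg21: "w \<in> X2 \<Longrightarrow> b \<le> card {u \<in> X1. R w u}"
    and deg23: "w \<in> X2 \<Longrightarrow> 2 * s \<le> card {z \<in> X3. R w z}" "w \<in> X2 \<Longrightarrow> card {z \<in> X3. R w z} \<le> 4 * s"
    and deg3: "z \<in> X3 \<Longrightarrow> 2 * T \<le> card {w. R z w}"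
    and par: "2 \<le> k" "k < s" "1 \<le> T" "3 \<le> q" "2 * q \<le> b" "k \<le> Suc (T * (q - 1))"
begin

lemma bip: "R x y \<Longrightarrow> x \<in> X2 \<longleftrightarrow> y \<notin> X2"
  using edge[of x y] disj by blast

lemma nbr: "u \<in> X1 \<union> X3 \<Longrightarrow> R u w \<Longrightarrow> w \<in> X2"
  using edge[of u w] disj by blast

definition off :: "'a list \<Rightarrow> 'a \<Rightarrow> 'a set" where
  "off P v = {u \<in> X1. R v u} - set P"

definition spaced_path :: "'a list \<Rightarrow> bool" where
  "spaced_path P \<longleftrightarrow> distinct P \<and> successively R P \<and> set P \<subseteq> X1 \<union> X2 \<union> X3 \<and>
     (\<forall>i j. i < j \<longrightarrow> j < length P \<longrightarrow> P ! i \<in> X1 \<longrightarrow> P ! j \<in> X1 \<longrightarrow> i + 2 * T \<le> j)"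

definition well_placed :: "'a list \<Rightarrow> bool" where
  "well_placed c \<longleftrightarrow> theta R k c \<and> set c \<subseteq> X1 \<union> X2 \<union> X3 \<and> (\<forall>v\<in>set c \<inter> X2. \<exists>u\<in>X1 - set c. R v u)"

lemma finite_off [simp]: "finite (off P v)"
  using fin by (simp add: off_def)

lemma well_placed_off:
  assumes "theta R k c" "set c \<subseteq> set P" "set P \<subseteq> X1 \<union> X2 \<union> X3"
    and "\<And>v. v \<in> set P \<inter> X2 \<Longrightarrow> off P v \<noteq> {}"
  shows "well_placed c"
  using assms unfolding well_placed_def off_def by blast

lemma spaced_pathD:
  assumes "spaced_path P" "i < j" "j < length P" "P ! i \<in> X1" "P ! j \<in> X1"
  shows "i + 2 * T \<le> j"
  using assms unfolding spaced_path_def by blast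

text \<open>By the spacing, the earliest of the \<open>q\<close> neighbours is at least
  \<open>2 * k - 1\<close> steps before \<open>c\<close> and closes the cycle. As
  \<open>q \<ge> 3\<close>, another one gives a chord that is not an edge of the path.\<close>

lemma theta_left:
  assumes P: "spaced_path P" and c: "c < length P"
    and J: "J \<subseteq> {j. j < c \<and> P ! j \<in> X1 \<and> R (P ! j) (P ! c)}" "q \<le> card J"
  shows "\<exists>c'. theta R k c' \<and> set c' = (!) P ` {Min J..c}"
proof -
  have fJ: "finite J" using J(1) by (rule finite_subset) simp
  have Jne: "J \<noteq> {}" using J(2) par by auto
  define a where "a = Min J"
  have a: "a \<in> J" "\<And>j. j \<in> J \<Longrightarrow> a \<le> j" using fJ Jne by (auto simp: a_def)
  have "a + 2 * T * (card J - 1) \<le> Max J" unfolding a_def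
  proof (rule spaced_set[OF fJ Jne])
    fix i j assume "i \<in> J" "j \<in> J" "i < j"
    then show "i + 2 * T \<le> j" using J(1) c by (intro spaced_pathD[OF P]) auto
  qed (use par in simp)
  moreover have "T * (q - 1) \<le> T * (card J - 1)" using J(2) by (intro mult_le_mono2) simp
  moreover have "Max J < c" using J(1) fJ Jne Max_in by blast
  ultimately have far: "2 * k \<le> Suc c - a" using par(6) by linarith
  have "card {a, c - 1} \<le> 2" by (simp add: card_insert_if)
  then have "\<not> J \<subseteq> {a, c - 1}" using J(2) par card_mono[of "{a, c - 1}" J] by auto
  then obtain d where d: "d \<in> J" "d \<noteq> a" "d \<noteq> c - 1" by auto
  have "a < d" using a(2)[OF d(1)] d(2) by simp
  moreover have "d < c" "R (P ! d) (P ! c)" using d(1) J(1) by auto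
  moreover have "a < c" "R (P ! a) (P ! c)" using a(1) J(1) by auto
  moreover have "Suc d \<noteq> c" using d(3) by auto
  ultimately show ?thesis unfolding a_def[symmetric]
    using P c far sym by (intro theta_segment[where b = d]) (auto simp: spaced_path_def)
qed

lemma theta_right:
  assumes P: "spaced_path P" and c: "c < length P"
    and J: "J \<subseteq> {j. c < j \<and> j < length P \<and> P ! j \<in> X1 \<and> R (P ! j) (P ! c)}" "q \<le> card J"
  shows "\<exists>c'. theta R k c' \<and> set c' = (!) P ` {c..Max J}"
proof -
  have fJ: "finite J" using J(1) by (rule finite_subset) simp
  have Jne: "J \<noteq> {}" using J(2) par by auto
  define a where "a = Max J"
  have a: "a \<in> J" "\<And>j. j \<in> J \<Longrightarrow> j \<le> a" using fJ Jne by (auto simp: a_def)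
  have "Min J + 2 * T * (card J - 1) \<le> a" unfolding a_def
  proof (rule spaced_set[OF fJ Jne])
    fix i j assume "i \<in> J" "j \<in> J" "i < j"
    then show "i + 2 * T \<le> j" using J(1) c by (intro spaced_pathD[OF P]) auto
  qed (use par in simp)
  moreover have "T * (q - 1) \<le> T * (card J - 1)" using J(2) by (intro mult_le_mono2) simp
  moreover have "c < Min J" using J(1) fJ Jne Min_in by blast
  ultimately have far: "2 * k \<le> Suc a - c" using par by linarith
  have "card {a, Suc c} \<le> 2" by (simp add: card_insert_if)
  then have "\<not> J \<subseteq> {a, Suc c}" using J(2) par card_mono[of "{a, Suc c}" J] by auto
  then obtain d where d: "d \<in> J" "d \<noteq> a" "d \<noteq> Suc c" by auto
  have "d < a" using a(2)[OF d(1)] d(2) by simp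
  moreover have "c < d" "R (P ! c) (P ! d)" using d(1) J(1) sym by auto
  moreover have "c < a" "R (P ! c) (P ! a)" "a < length P" using a(1) J(1) sym by auto
  ultimately show ?thesis unfolding a_def[symmetric]
    using P far sym d(3) by (intro theta_segment[where b = d]) (auto simp: spaced_path_def)
qed

lemma spaced_path_append:
  assumes "spaced_path P" "P \<noteq> []" "R (last P) x" "x \<notin> set P" "x \<notin> X1"
  shows "spaced_path (P @ [x])"
  unfolding spaced_path_def
proof (intro conjI allI impI)
  show "distinct (P @ [x])" using assms by (simp add: spaced_path_def)
  show "successively R (P @ [x])" using assms by (simp add: spaced_path_def successively_append_iff)
  show "set (P @ [x]) \<subseteq> X1 \<union> X2 \<union> X3" using assms edge[of "last P" x] by (auto simp: spaced_path_def)
  fix i j assume *: "i < j" "j < length (P @ [x])" "(P @ [x]) ! i \<in> X1" "(P @ [x]) ! j \<in> X1"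
  then have "j \<noteq> length P" using assms(5) by auto
  then have "j < length P" using * by simp
  then show "i + 2 * T \<le> j" using assms(1) * unfolding spaced_path_def by (metis nth_append less_trans)
qed

lemma off_append: "x \<notin> X1 \<Longrightarrow> off (P @ [x]) v = off P v"
  by (auto simp: off_def)

lemma card_nbr_indices:
  assumes "v \<in> X2" "card (off P v) \<le> 1" "distinct P"
  shows "b \<le> Suc (card {j. j < length P \<and> P ! j \<in> X1 \<and> R (P ! j) v})" (is "_ \<le> Suc (card ?J)")
proof -
  have "{u \<in> X1. R v u} \<subseteq> off P v \<union> (!) P ` ?J"
    using sym by (auto simp: off_def in_set_conv_nth)
  then have "card {u \<in> X1. R v u} \<le> card (off P v \<union> (!) P ` ?J)" by (intro card_mono) auto
  also have "\<dots> \<le> card (off P v) + card ((!) P ` ?J)" by (rule card_Un_le)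
  also have "\<dots> \<le> 1 + card ?J" using assms(2) by (intro add_mono card_image_le) auto
  finally show ?thesis using deg21[OF assms(1)] by simp
qed

text \<open>The cycle omits one \<open>X1\<close>-neighbour of \<open>v\<close>, which keeps \<open>v\<close> itself well placed.\<close>

lemma card_off_new:
  assumes P: "spaced_path P" "P \<noteq> []" and v: "v \<in> X2" "v \<notin> set P" "R (last P) v"
    and offP: "\<And>w. w \<in> set P \<inter> X2 \<Longrightarrow> off P w \<noteq> {}" and none: "\<And>c. \<not> well_placed c"
  shows "2 \<le> card (off P v)"
proof (rule ccontr)
  assume "\<not> ?thesis"
  then have le1: "card (off P v) \<le> 1" by simp
  define P' where "P' = P @ [v]"
  have v1: "v \<notin> X1" using v disj by auto
  have P': "spaced_path P'" unfolding P'_def using P v v1 by (intro spaced_path_append)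
  define J0 where "J0 = {j. j < length P \<and> P ! j \<in> X1 \<and> R (P ! j) v}"
  have f0: "finite J0" by (simp add: J0_def)
  have c0: "b \<le> Suc (card J0)" unfolding J0_def using v le1 P by (intro card_nbr_indices) (auto simp: spaced_path_def)
  then have "J0 \<noteq> {}" using par by auto
  define a0 where "a0 = Min J0"
  have a0: "a0 \<in> J0" "\<And>j. j \<in> J0 \<Longrightarrow> a0 \<le> j" using f0 \<open>J0 \<noteq> {}\<close> by (auto simp: a0_def)
  define J where "J = J0 - {a0}"
  have cJ: "q \<le> card J" using c0 a0 f0 par by (simp add: J_def)
  have "finite J" using f0 by (simp add: J_def)
  moreover have "J \<noteq> {}" using cJ par by auto
  ultimately have fJ: "finite J" "J \<noteq> {}" .
  have "J \<subseteq> {j. j < length P \<and> P' ! j \<in> X1 \<and> R (P' ! j) (P' ! length P)}"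
    by (auto simp: J_def J0_def P'_def nth_append)
  then obtain c where c: "theta R k c" "set c = (!) P' ` {Min J..length P}"
    using theta_left[OF P', of "length P" J] cJ by (auto simp: P'_def)
  have "a0 < Min J" using Min_in[OF fJ] a0(2) unfolding J_def by (metis DiffE le_neq_implies_less singletonI)
  have dist: "distinct P'" using P' by (simp add: spaced_path_def)
  have sub: "set c \<subseteq> set P'" using c(2) by (auto simp: P'_def set_conv_nth[of "P @ [v]"] simp del: set_append)
  have "P ! a0 \<notin> set c"
  proof
    assume "P ! a0 \<in> set c"
    then obtain j where j: "P ! a0 = P' ! j" "Min J \<le> j" "j \<le> length P" using c(2) by auto
    have "P' ! a0 = P' ! j" using j(1) a0(1) by (simp add: J0_def P'_def nth_append)
    moreover have "a0 < length P'" "j < length P'" using a0(1) j(3) by (auto simp: J0_def P'_def)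
    ultimately have "a0 = j" using dist nth_eq_iff_index_eq by blast
    then show False using j(2) \<open>a0 < Min J\<close> by simp
  qed
  moreover have "P ! a0 \<in> X1" "R v (P ! a0)" using a0(1) sym by (auto simp: J0_def)
  ultimately have vok: "\<exists>u\<in>X1 - set c. R v u" by blast
  have "\<exists>u\<in>X1 - set c. R w u" if "w \<in> set c \<inter> X2" for w
  proof (cases "w = v")
    case False
    then have "w \<in> set P \<inter> X2" using that sub by (auto simp: P'_def)
    then obtain u where "u \<in> off P w" using offP by blast
    then have "u \<in> X1 - set c" "R w u" using sub v1 by (auto simp: off_def P'_def)
    then show ?thesis by blast
  qed (use vok in simp)
  moreover have "set P' \<subseteq> X1 \<union> X2 \<union> X3" using P' by (simp add: spaced_path_def)
  ultimately have "well_placed c" using c(1) sub by (auto simp: well_placed_def)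
  then show False using none by blast
qed

text \<open>Appending \<open>u\<close> takes at most one free neighbour from each vertex of
  \<open>X2\<close>, so one is left, and every theta graph on the longer path is well placed. A
  vertex with at most one left has at least \<open>2 * q - 1\<close> neighbours on the path, hence
  \<open>q\<close> before it or \<open>q\<close> after it, and these yield a theta graph.\<close>

lemma card_off_old:
  assumes P: "spaced_path (P @ [u])" and u: "u \<in> X1"
    and offP: "\<And>w. w \<in> set P \<inter> X2 \<Longrightarrow> 2 \<le> card (off P w)" and none: "\<And>c. \<not> well_placed c"
    and v: "v \<in> set (P @ [u]) \<inter> X2"
  shows "2 \<le> card (off (P @ [u]) v)"
proof (rule ccontr)
  define P' where "P' = P @ [u]"
  assume "\<not> 2 \<le> card (off (P @ [u]) v)"
  then have le1: "card (off P' v) \<le> 1" by (simp add: P'_def)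
  have sp: "spaced_path P'" using P by (simp add: P'_def)
  obtain c where c: "c < length P'" "P' ! c = v" using v by (metis IntD1 P'_def in_set_conv_nth)
  define J where "J = {j. j < length P' \<and> P' ! j \<in> X1 \<and> R (P' ! j) v}"
  have cJ: "b \<le> Suc (card J)" unfolding J_def using v le1 sp by (intro card_nbr_indices) (auto simp: spaced_path_def)
  have "c \<notin> J" using c v disj by (auto simp: J_def)
  define J1 where "J1 = {j \<in> J. j < c}"
  define J2 where "J2 = {j \<in> J. c < j}"
  have "J = J1 \<union> J2" unfolding J1_def J2_def using \<open>c \<notin> J\<close> nat_neq_iff by blast
  then have "card J \<le> card J1 + card J2" using card_Un_le by metis
  then have "q \<le> card J1 \<or> q \<le> card J2" using cJ par by linarith
  then have "\<exists>c'. theta R k c' \<and> set c' \<subseteq> set P'"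
  proof
    assume q: "q \<le> card J1"
    have "J1 \<subseteq> {j. j < c \<and> P' ! j \<in> X1 \<and> R (P' ! j) (P' ! c)}" using c by (auto simp: J1_def J_def)
    then obtain c' where "theta R k c'" "set c' = (!) P' ` {Min J1..c}" using theta_left[OF sp c(1)] q by blast
    moreover have "(!) P' ` {Min J1..c} \<subseteq> set P'" using c(1) by auto
    ultimately show ?thesis by (intro exI[of _ c']) simp
  next
    assume q: "q \<le> card J2"
    have J2: "J2 \<subseteq> {j. c < j \<and> j < length P' \<and> P' ! j \<in> X1 \<and> R (P' ! j) (P' ! c)}" using c by (auto simp: J2_def J_def)
    then obtain c' where "theta R k c'" "set c' = (!) P' ` {c..Max J2}" using theta_right[OF sp c(1)] q by blast
    moreover have "finite J2" by (simp add: J2_def J_def)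
    moreover have "J2 \<noteq> {}" using q par by auto
    ultimately have "Max J2 < length P'" using J2 Max_in by blast
    then have "(!) P' ` {c..Max J2} \<subseteq> set P'" by auto
    moreover note \<open>theta R k c'\<close> \<open>set c' = (!) P' ` {c..Max J2}\<close>
    ultimately show ?thesis by (intro exI[of _ c']) simp
  qed
  then obtain c' where c': "theta R k c'" "set c' \<subseteq> set P'" by blast
  have "off P' w \<noteq> {}" if "w \<in> set P' \<inter> X2" for w
  proof -
    have "w \<in> set P \<inter> X2" using that u disj by (auto simp: P'_def)
    then have "2 \<le> card (off P w)" by (rule offP)
    then have "\<not> off P w \<subseteq> {u}" using card_mono[of "{u}" "off P w"] by auto
    then show ?thesis by (auto simp: off_def P'_def)
  qed
  then have "well_placed c'" using c' sp by (intro well_placed_off[of c' P']) (auto simp: spaced_path_def)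
  then show False using none by blast
qed

end

section \<open>Dead ends and the extension of the path\<close>

context trilayer
begin

text \<open>From a vertex of \<open>X2\<close> outside \<open>bad Q t\<close>, the path can make
  \<open>t\<close> excursions to \<open>X3\<close> and back without touching \<open>Q\<close>, even
  if at each of them \<open>s - 1\<close> choices in \<open>X3\<close> and \<open>T\<close> choices
  in \<open>X2\<close> are blocked.\<close>

primrec bad :: "'a set \<Rightarrow> nat \<Rightarrow> 'a set" where
  "bad Q 0 = Q"
| "bad Q (Suc t) = bad Q t \<union> {w \<in> X2. card {z \<in> X3. R w z \<and> T < card ({w'. R z w'} - bad Q t)} < s}"

lemma bad_subset: "Q \<subseteq> X2 \<Longrightarrow> bad Q t \<subseteq> X2"
  by (induction t) auto

lemma bad_superset: "Q \<subseteq> bad Q t"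
  by (induction t) auto

text \<open>Double counting over the set \<open>Sp\<close> of vertices in \<open>X3\<close> with at
  most \<open>T\<close> neighbours outside \<open>X = bad Q t\<close>. Each has at least
  \<open>T\<close> neighbours in \<open>X\<close>, where degrees are at most \<open>4 * s\<close>,
  so \<open>T * card Sp \<le> 4 * s * card X\<close>. Each new bad vertex has at least
  \<open>s\<close> neighbours in \<open>Sp\<close>, each vertex of \<open>Sp\<close> at most
  \<open>T\<close> new ones. So at most \<open>4 * card X\<close> vertices are new.\<close>

lemma card_bad_Suc:
  assumes "Q \<subseteq> X2"
  shows "card (bad Q (Suc t)) \<le> 5 * card (bad Q t)"
proof -
  define X where "X = bad Q t"
  define Sp where "Sp = {z \<in> X3. card ({w'. R z w'} - X) \<le> T}"
  define New where "New = bad Q (Suc t) - X"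
  have X: "X \<subseteq> X2" "finite X" using bad_subset[OF assms] fin(2) by (auto simp: X_def intro: finite_subset)
  have New: "New \<subseteq> X2" "finite New" "New \<inter> X = {}"
    using bad_subset[OF assms, of "Suc t"] fin(2) unfolding New_def by (auto intro: finite_subset)
  have fSp: "finite Sp" using fin by (simp add: Sp_def)
  have finN: "finite {w'. R z w'}" if "z \<in> X3" for z
  proof -
    have "{w'. R z w'} \<subseteq> X2" using nbr that by blast
    then show ?thesis using fin(2) by (rule finite_subset)
  qed
  have "T * card Sp = (\<Sum>z\<in>Sp. T)" by simp
  also have "\<dots> \<le> (\<Sum>z\<in>Sp. card {w \<in> X. R z w})"
  proof (rule sum_mono)
    fix z assume z: "z \<in> Sp"
    then have z3: "z \<in> X3" by (simp add: Sp_def)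
    have "{w'. R z w'} = ({w'. R z w'} - X) \<union> {w \<in> X. R z w}" by auto
    then have "card {w'. R z w'} \<le> card ({w'. R z w'} - X) + card {w \<in> X. R z w}"
      by (metis card_Un_le)
    then show "T \<le> card {w \<in> X. R z w}" using z deg3[OF z3] by (simp add: Sp_def)
  qed
  also have "\<dots> = (\<Sum>w\<in>X. card {z \<in> Sp. R z w})" using fSp X(2) by (rule sum_card_swap)
  also have "\<dots> \<le> (\<Sum>w\<in>X. 4 * s)"
  proof (rule sum_mono)
    fix w assume "w \<in> X"
    then have "card {z \<in> X3. R w z} \<le> 4 * s" using deg23(2) X(1) by auto
    moreover have "card {z \<in> Sp. R z w} \<le> card {z \<in> X3. R w z}"
      using fin(3) sym by (intro card_mono) (auto simp: Sp_def)
    ultimately show "card {z \<in> Sp. R z w} \<le> 4 * s" by simp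
  qed
  finally have Sp: "T * card Sp \<le> s * (4 * card X)" by (simp add: mult_ac)
  have "s * card New = (\<Sum>w\<in>New. s)" by simp
  also have "\<dots> \<le> (\<Sum>w\<in>New. card {z \<in> Sp. R w z})"
  proof (rule sum_mono)
    fix w assume w: "w \<in> New"
    let ?good = "{z \<in> X3. R w z \<and> T < card ({w'. R z w'} - X)}"
    have "card ?good < s" using w by (auto simp: New_def X_def)
    moreover have "{z \<in> X3. R w z} = ?good \<union> {z \<in> Sp. R w z}" by (auto simp: Sp_def)
    then have "card {z \<in> X3. R w z} \<le> card ?good + card {z \<in> Sp. R w z}" by (simp only: card_Un_le)
    moreover have "2 * s \<le> card {z \<in> X3. R w z}" using deg23(1) w New(1) by blast
    ultimately show "s \<le> card {z \<in> Sp. R w z}" by simp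
  qed
  also have "\<dots> = (\<Sum>z\<in>Sp. card {w \<in> New. R w z})" using New(2) fSp by (rule sum_card_swap)
  also have "\<dots> \<le> (\<Sum>z\<in>Sp. T)"
  proof (rule sum_mono)
    fix z assume z: "z \<in> Sp"
    then have "card {w \<in> New. R w z} \<le> card ({w'. R z w'} - X)"
      using finN[of z] sym New(3) by (intro card_mono) (auto simp: Sp_def)
    then show "card {w \<in> New. R w z} \<le> T" using z by (simp add: Sp_def)
  qed
  also have "\<dots> = T * card Sp" by simp
  also note Sp
  finally have "s * card New \<le> s * (4 * card X)" .
  then have "card New \<le> 4 * card X" using par by simp
  moreover have "bad Q (Suc t) = X \<union> New" by (auto simp: New_def X_def)
  then have "card (bad Q (Suc t)) \<le> card X + card New" by (metis card_Un_le)
  ultimately show ?thesis by (simp add: X_def)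
qed

lemma card_bad: "Q \<subseteq> X2 \<Longrightarrow> card (bad Q t) \<le> card Q * 5 ^ t"
proof (induction t)
  case (Suc t)
  then show ?case using card_bad_Suc[of Q t] by simp
qed simp

text \<open>Two free neighbours are kept because the next vertex of the path in \<open>X1\<close>
  may take one of them, and theta graphs on the longer path still have to be well placed.\<close>

definition invar :: "'a list \<Rightarrow> bool" where
  "invar P \<longleftrightarrow> P \<noteq> [] \<and> spaced_path P \<and> (\<forall>v\<in>set P \<inter> X2. 2 \<le> card (off P v))"

lemma invarD:
  assumes "invar P"
  shows "P \<noteq> []" "spaced_path P" "set P \<subseteq> X1 \<union> X2 \<union> X3"
    and "\<And>v. v \<in> set P \<inter> X2 \<Longrightarrow> 2 \<le> card (off P v)"
    and "\<And>v. v \<in> set P \<inter> X2 \<Longrightarrow> off P v \<noteq> {}"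
proof -
  show "P \<noteq> []" "spaced_path P" "set P \<subseteq> X1 \<union> X2 \<union> X3" and *: "\<And>v. v \<in> set P \<inter> X2 \<Longrightarrow> 2 \<le> card (off P v)"
    using assms unfolding invar_def spaced_path_def by blast+
  show "off P v \<noteq> {}" if "v \<in> set P \<inter> X2" for v using *[OF that] by auto
qed

lemma few_nbrs_on_path:
  assumes "invar P" and none: "\<And>c. \<not> well_placed c"
  shows "card {y \<in> set P. R (last P) y} \<le> k"
proof (rule ccontr)
  assume "\<not> ?thesis"
  then obtain c where "theta R k c" "set c \<subseteq> set P"
    using theta_many_nbrs[where E = R and S = X2 and P = P and k = k] sym bip par assms(1)
    unfolding invar_def spaced_path_def by (metis not_less)
  then have "well_placed c" using invarD[OF assms(1)] by (intro well_placed_off[of c P])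
  then show False using none by blast
qed

lemma invar_append_X3:
  assumes "invar P" "R (last P) z" "z \<notin> set P" "z \<in> X3"
  shows "invar (P @ [z])"
proof -
  have z: "z \<notin> X1" "z \<notin> X2" using assms(4) disj by auto
  then show ?thesis
    using assms spaced_path_append[of P z] by (auto simp: invar_def off_append)
qed

lemma invar_append_X2:
  assumes P: "invar P" "R (last P) w" "w \<notin> set P" "w \<in> X2" and none: "\<And>c. \<not> well_placed c"
  shows "invar (P @ [w])"
proof -
  have w: "w \<notin> X1" using assms(4) disj by auto
  have "2 \<le> card (off P w)"
    using invarD(2,1)[OF P(1)] P(4,3,2) invarD(5)[OF P(1)] none by (rule card_off_new)
  then show ?thesis
    using assms w spaced_path_append[of P w] by (auto simp: invar_def off_append)
qed

text \<open>Of two such neighbours, the earlier one would close a cycle on more than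
  \<open>2 * k\<close> vertices and the later one would give its chord. So only the last
  \<open>2 * k\<close> vertices of \<open>P\<close> need another way of being avoided: those in
  \<open>X2\<close> form the set \<open>Q\<close> from which the bad sets start.\<close>

lemma far_nbrs:
  assumes P: "invar (P @ ys)" "last (P @ ys) \<in> X3" and none: "\<And>c. \<not> well_placed c"
  shows "card {w \<in> set P - set (drop (length P - 2 * k) P). R (last (P @ ys)) w} \<le> 1"
proof (rule ccontr)
  define P' where "P' = P @ ys"
  define n where "n = length P' - 1"
  let ?F = "{w \<in> set P - set (drop (length P - 2 * k) P). R (last (P @ ys)) w}"
  assume "\<not> card ?F \<le> 1"
  then have "\<not> (\<forall>x\<in>?F. \<forall>y\<in>?F. x = y)" using card_le_Suc0_iff_eq[of ?F] by auto
  then obtain x y where xy: "x \<in> ?F" "y \<in> ?F" "x \<noteq> y" by blast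
  have ind: "\<exists>i. i + 2 * k < length P \<and> P ! i = w" if w: "w \<in> ?F" for w
  proof -
    obtain i where i: "i < length P" "P ! i = w" using w by (auto simp: in_set_conv_nth)
    have "i < length P - 2 * k"
    proof (rule ccontr)
      assume "\<not> ?thesis"
      then have "w \<in> set (drop (length P - 2 * k) P)"
        using i by (auto simp: in_set_conv_nth intro!: exI[of _ "i - (length P - 2 * k)"])
      then show False using w by simp
    qed
    then show ?thesis using i by (intro exI[of _ i]) auto
  qed
  obtain i where i: "i + 2 * k < length P" "P ! i = x" using ind[OF xy(1)] by blast
  obtain j where j: "j + 2 * k < length P" "P ! j = y" using ind[OF xy(2)] by blast
  note P' = invarD[OF P(1), folded P'_def]
  note sp = P'(2) and ne = P'(1)
  then have lastP: "last (P @ ys) = P' ! n" "n < length P'" by (auto simp: P'_def n_def last_conv_nth)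
  have lenP: "length P \<le> Suc n" using i by (simp add: n_def P'_def)
  have R: "R (P' ! i) (P' ! n)" "R (P' ! j) (P' ! n)"
    using xy(1,2) i j sym unfolding lastP(1) by (auto simp: P'_def nth_append)
  have "\<exists>c. theta R k c \<and> set c = (!) P' ` {a..n}"
    if "a < d" "d + 2 * k < length P" "R (P' ! a) (P' ! n)" "R (P' ! d) (P' ! n)" for a d
    using that sp lenP lastP par sym
    by (intro theta_segment[where b = d]) (auto simp: spaced_path_def)
  moreover have "i \<noteq> j" using xy i j by auto
  ultimately obtain a c where c: "theta R k c" "set c = (!) P' ` {a..n}"
    using R i j by (metis nat_neq_iff)
  have "(!) P' ` {a..n} \<subseteq> set P'" using lastP(2) by auto
  then have "well_placed c" using c P' by (intro well_placed_off[of c P']) auto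
  then show False using none by blast
qed

text \<open>\<open>i\<close> counts the visits to \<open>X2\<close>. As \<open>T - i\<close> of them
  are still to come, the current end has to lie outside \<open>bad Q (T - i)\<close>.\<close>

lemma extend_segment:
  assumes P: "invar P" "last P \<in> X1" and none: "\<And>c. \<not> well_placed c"
    and Q: "Q = set (drop (length P - 2 * k) P) \<inter> X2" and i: "1 \<le> i" "i \<le> T"
  shows "\<exists>ys. invar (P @ ys) \<and> Suc (length ys) = 2 * i \<and> set ys \<inter> X1 = {} \<and>
           card (set ys \<inter> X2) \<le> i \<and> last (P @ ys) \<in> X2 - bad Q (T - i)"
  using i
proof (induction i rule: dec_induct)
  case base
  have QX: "Q \<subseteq> X2" using Q by auto
  have "card Q \<le> card (set (drop (length P - 2 * k) P))" unfolding Q by (intro card_mono) auto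
  also have "\<dots> \<le> 2 * k" using card_length[of "drop (length P - 2 * k) P"] by simp
  finally have "card (bad Q (T - 1)) \<le> 2 * k * 5 ^ (T - 1)"
    using card_bad[OF QX, of "T - 1"] by (meson le_trans mult_le_mono1)
  also have "\<dots> \<le> 2 * k * 5 ^ T" by (intro mult_le_mono2 power_increasing) auto
  finally have cb: "card (bad Q (T - 1)) \<le> 2 * k * 5 ^ T" .
  have fb: "finite (bad Q (T - 1))" using bad_subset[OF QX] fin(2) by (rule finite_subset)
  have "\<not> {w. R (last P) w} \<subseteq> bad Q (T - 1) \<union> {y \<in> set P. R (last P) y}"
  proof
    assume "{w. R (last P) w} \<subseteq> bad Q (T - 1) \<union> {y \<in> set P. R (last P) y}"
    then have "card {w. R (last P) w} \<le> card (bad Q (T - 1) \<union> {y \<in> set P. R (last P) y})"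
      using fb by (intro card_mono) auto
    also have "\<dots> \<le> card (bad Q (T - 1)) + card {y \<in> set P. R (last P) y}" by (rule card_Un_le)
    finally show False using cb few_nbrs_on_path[OF P(1) none] deg1[OF P(2)] by linarith
  qed
  then obtain w where w: "R (last P) w" "w \<notin> bad Q (T - 1)" "w \<notin> set P" by blast
  have "w \<in> X2" using nbr[of "last P" w] w P(2) by simp
  moreover have "invar (P @ [w])" using P w \<open>w \<in> X2\<close> none by (intro invar_append_X2)
  moreover have "w \<notin> X1" using \<open>w \<in> X2\<close> disj by auto
  ultimately show ?case using w by (intro exI[of _ "[w]"]) auto
next
  case (step i)
  then obtain ys where ys: "invar (P @ ys)" "Suc (length ys) = 2 * i" "set ys \<inter> X1 = {}"
    "card (set ys \<inter> X2) \<le> i" "last (P @ ys) \<in> X2 - bad Q (T - i)" by auto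
  define t where "t = T - Suc i"
  have "T - i = Suc t" using step by (simp add: t_def)
  define w where "w = last (P @ ys)"
  let ?Z = "{z \<in> X3. R w z \<and> T < card ({w'. R z w'} - bad Q t)}"
  have w: "w \<in> X2" "s \<le> card ?Z" using ys(5) \<open>T - i = Suc t\<close> by (auto simp: w_def)
  have "\<not> ?Z \<subseteq> {y \<in> set (P @ ys). R w y}"
  proof
    assume "?Z \<subseteq> {y \<in> set (P @ ys). R w y}"
    then have "card ?Z \<le> card {y \<in> set (P @ ys). R w y}" by (intro card_mono) auto
    then show False using w(2) par few_nbrs_on_path[OF ys(1) none] by (simp add: w_def)
  qed
  then obtain z where z: "z \<in> X3" "R w z" "T < card ({w'. R z w'} - bad Q t)" "z \<notin> set (P @ ys)" by blast
  have inv: "invar (P @ (ys @ [z]))" using invar_append_X3[OF ys(1), of z] z by (simp add: w_def)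
  let ?F = "{w \<in> set P - set (drop (length P - 2 * k) P). R (last (P @ (ys @ [z]))) w}"
  \<comment> \<open>Besides the bad vertices, which include the recent part \<open>Q\<close> of
    \<open>P\<close>, only the at most \<open>i\<close> vertices of \<open>ys\<close> in
    \<open>X2\<close> and at most one vertex of the older part of \<open>P\<close> are blocked.
    Since \<open>i < T\<close>, the more than \<open>T\<close> candidates suffice.\<close>
  have "\<not> {w'. R z w'} - bad Q t \<subseteq> (set ys \<inter> X2) \<union> ?F"
  proof
    assume "{w'. R z w'} - bad Q t \<subseteq> (set ys \<inter> X2) \<union> ?F"
    then have "card ({w'. R z w'} - bad Q t) \<le> card ((set ys \<inter> X2) \<union> ?F)" by (intro card_mono) auto
    also have "\<dots> \<le> card (set ys \<inter> X2) + card ?F" by (rule card_Un_le)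
    also have "\<dots> \<le> i + 1" using ys(4) far_nbrs[OF inv _ none] z(1) by (intro add_mono) auto
    finally show False using z(3) step by simp
  qed
  then obtain w' where w': "R z w'" "w' \<notin> bad Q t" "w' \<notin> set ys \<inter> X2" "w' \<notin> ?F" by blast
  have w'2: "w' \<in> X2" "w' \<notin> X1" using nbr[of z w'] w' z(1) disj by auto
  have "w' \<notin> Q" using w'(2) bad_superset by blast
  then have fresh: "w' \<notin> set (P @ (ys @ [z]))" using w' w'2 z(1) Q disj by auto
  have "invar (P @ (ys @ [z, w']))"
    using invar_append_X2[OF inv _ fresh w'2(1) none] w' by simp
  moreover have "card (set (ys @ [z, w']) \<inter> X2) \<le> Suc i"
  proof -
    have "set (ys @ [z, w']) \<inter> X2 \<subseteq> insert w' (set ys \<inter> X2)" using z(1) disj by auto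
    then have "card (set (ys @ [z, w']) \<inter> X2) \<le> card (insert w' (set ys \<inter> X2))" by (intro card_mono) auto
    also have "\<dots> \<le> Suc (card (set ys \<inter> X2))" by (simp add: card_insert_if)
    finally show ?thesis using ys(4) by simp
  qed
  ultimately show ?case using ys z w' w'2 disj
    by (intro exI[of _ "ys @ [z, w']"]) (auto simp: t_def)
qed

text \<open>The \<open>2 * T - 1\<close> vertices of \<open>ys\<close> avoid \<open>X1\<close>, so
  that the next vertex in \<open>X1\<close> comes exactly \<open>2 * T\<close> steps after the end
  of \<open>P\<close>. A free neighbour of the last vertex of \<open>ys\<close> serves as this next
  vertex.\<close>

lemma extend_path:
  assumes P: "invar P" "last P \<in> X1" and none: "\<And>c. \<not> well_placed c"
  shows "\<exists>P'. invar P' \<and> last P' \<in> X1 \<and> length P < length P'"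
proof -
  obtain ys where ys: "invar (P @ ys)" "Suc (length ys) = 2 * T" "set ys \<inter> X1 = {}" "last (P @ ys) \<in> X2"
    using extend_segment[OF P none refl, of T] par by auto
  define P1 where "P1 = P @ ys"
  have "ys \<noteq> []" using ys(2) by auto
  then have "last P1 \<in> set P1 \<inter> X2" using ys(4) by (auto simp: P1_def)
  then have "2 \<le> card (off P1 (last P1))" using ys(1) by (simp add: invar_def P1_def)
  then obtain u where "u \<in> off P1 (last P1)" by fastforce
  then have u: "u \<in> X1" "R (last P1) u" "u \<notin> set P1" by (auto simp: off_def)
  have P1: "spaced_path P1" "P1 \<noteq> []" "\<And>v. v \<in> set P1 \<inter> X2 \<Longrightarrow> 2 \<le> card (off P1 v)"
    using ys(1) by (auto simp: invar_def P1_def)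
  have "spaced_path (P1 @ [u])" unfolding spaced_path_def
  proof (intro conjI allI impI)
    show "distinct (P1 @ [u])" "set (P1 @ [u]) \<subseteq> X1 \<union> X2 \<union> X3" "successively R (P1 @ [u])"
      using P1 u by (auto simp: spaced_path_def successively_append_iff)
    fix i j assume *: "i < j" "j < length (P1 @ [u])" "(P1 @ [u]) ! i \<in> X1" "(P1 @ [u]) ! j \<in> X1"
    then have i: "P1 ! i \<in> X1" "i < length P1" by (auto simp: nth_append)
    show "i + 2 * T \<le> j"
    proof (cases "j = length P1")
      case True
      have "i < length P"
      proof (rule ccontr)
        assume "\<not> i < length P"
        then have "P1 ! i \<in> set ys" using i(2) by (auto simp: P1_def nth_append)
        then show False using i(1) ys(3) by blast
      qed
      then show ?thesis using True ys(2) by (simp add: P1_def)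
    next
      case False
      then have "j < length P1" "P1 ! j \<in> X1" using * by (auto simp: nth_append)
      then show ?thesis using spaced_pathD[OF P1(1) *(1)] i by blast
    qed
  qed
  then have "invar (P1 @ [u])"
    using card_off_old[OF _ u(1) P1(3) none] by (simp add: invar_def)
  then show ?thesis using u(1) by (intro exI[of _ "P1 @ [u]"]) (simp add: P1_def)
qed

theorem well_placed_theta:
  assumes "X1 \<noteq> {}"
  shows "\<exists>c. well_placed c"
proof (rule ccontr)
  assume "\<not> ?thesis"
  then have none: "\<And>c. \<not> well_placed c" by blast
  define ok where "ok P \<longleftrightarrow> invar P \<and> last P \<in> X1" for P
  obtain u where u: "u \<in> X1" using assms by blast
  then have "ok [u]" using disj by (auto simp: ok_def invar_def spaced_path_def)
  moreover have "length P < Suc (card (X1 \<union> X2 \<union> X3))" if "ok P" for P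
    using that fin card_mono[of "X1 \<union> X2 \<union> X3" "set P"]
    by (auto simp: ok_def invar_def spaced_path_def distinct_card)
  ultimately obtain P where "ok P" "\<And>P'. ok P' \<Longrightarrow> length P' \<le> length P"
    using ex_has_greatest_nat[of ok "[u]" length] by blast
  then show False using extend_path[of P] none unfolding ok_def by (meson not_less)
qed

end

section \<open>Growth of the layers\<close>

lemma sum_card_remove:
  assumes "finite Y" "finite X" "u \<in> X"
  shows "(\<Sum>w\<in>Y. card (N w \<inter> X)) = (\<Sum>w\<in>Y. card (N w \<inter> (X - {u}))) + card {w \<in> Y. u \<in> N w}"
proof -
  have "card (N w \<inter> X) = card (N w \<inter> (X - {u})) + (if u \<in> N w then 1 else 0)" for w
  proof -
    have "N w \<inter> X = (if u \<in> N w then insert u (N w \<inter> (X - {u})) else N w \<inter> (X - {u}))"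
      using assms(3) by auto
    then show ?thesis using assms(2) by simp
  qed
  then show ?thesis using assms(1) by (simp add: sum.distrib sum.If_cases Int_def)
qed

lemma theta_mono:
  assumes "theta R k c" "\<And>x y. R x y \<Longrightarrow> E x y"
  shows "theta E k c"
  using assms unfolding theta_def by (auto intro: successively_mono)

text \<open>Each vertex of \<open>U\<close> keeps exactly \<open>b\<close> edges to \<open>V1\<close> and \<open>4 * s\<close> edges to \<open>V3\<close>. In the triple of
  subsets that maximises \<open>\<Phi>\<close>, no vertex can be deleted with profit; the weights are chosen such that
  this forces all the degree conditions at once.\<close>

lemma trilayer_theta:
  fixes E :: "'a \<Rightarrow> 'a \<Rightarrow> bool"
  assumes fin: "finite V1" "finite U" "finite V3"
    and disj: "V1 \<inter> U = {}" "V1 \<inter> V3 = {}" "U \<inter> V3 = {}"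
    and sym: "\<And>x y. E x y \<Longrightarrow> E y x"
    and par: "2 \<le> k" "k < s" "1 \<le> T" "3 \<le> q" "2 * q \<le> b" "k \<le> Suc (T * (q - 1))"
    and bwd: "\<And>w. w \<in> U \<Longrightarrow> b \<le> card {u \<in> V1. E w u}"
    and fwd: "\<And>w. w \<in> U \<Longrightarrow> 4 * s \<le> card {z \<in> V3. E w z}"
    and big: "4 * s * (2 * k * 5 ^ T + k + 1) * card V1 + 2 * T * card V3 < 2 * s * card U"
  shows "\<exists>c. theta E k c \<and> set c \<subseteq> V1 \<union> U \<union> V3 \<and> (\<forall>v\<in>set c \<inter> U. \<exists>u\<in>V1 - set c. E v u)"
proof -
  define A where "A = 2 * k * 5 ^ T + k + 1"
  have "\<exists>N. N \<subseteq> {u \<in> V1. E w u} \<and> card N = b" if "w \<in> U" for w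
    using obtain_subset_with_card_n[OF bwd[OF that]] by metis
  then obtain N1 where N1: "\<And>w. w \<in> U \<Longrightarrow> N1 w \<subseteq> {u \<in> V1. E w u}" "\<And>w. w \<in> U \<Longrightarrow> card (N1 w) = b"
    by metis
  have "\<exists>N. N \<subseteq> {z \<in> V3. E w z} \<and> card N = 4 * s" if "w \<in> U" for w
    using obtain_subset_with_card_n[OF fwd[OF that]] by metis
  then obtain N3 where N3: "\<And>w. w \<in> U \<Longrightarrow> N3 w \<subseteq> {z \<in> V3. E w z}" "\<And>w. w \<in> U \<Longrightarrow> card (N3 w) = 4 * s"
    by metis
  \<comment> \<open>Weighted edges minus a charge for each vertex. An edge to \<open>X1\<close>
    weighs \<open>4 * s\<close>, as much as all edges that a vertex of \<open>X2\<close> keeps to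
    \<open>V3\<close>. The charge is the weighted degree that a vertex must have to stay:
    \<open>A\<close> edges in \<open>X1\<close>, \<open>2 * T\<close> edges in \<open>X3\<close>,
    and \<open>b\<close> edges up together with \<open>2 * s\<close> edges down in
    \<open>X2\<close>.\<close>
  define \<Phi> where "\<Phi> = (\<lambda>(X1, X2, X3). 4 * int s * int (\<Sum>w\<in>X2. card (N1 w \<inter> X1)) + int (\<Sum>w\<in>X2. card (N3 w \<inter> X3))
     - 4 * int s * int A * int (card X1) - (4 * int s * int b + 2 * int s) * int (card X2) - 2 * int T * int (card X3))"
  define D where "D = Pow V1 \<times> Pow U \<times> Pow V3"
  have "finite D" "D \<noteq> {}" using fin by (auto simp: D_def)
  then have "Max (\<Phi> ` D) \<in> \<Phi> ` D" by (intro Max_in) auto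
  then obtain X where X: "X \<in> D" "\<Phi> X = Max (\<Phi> ` D)" by auto
  have maxX: "\<Phi> Y \<le> \<Phi> X" if "Y \<in> D" for Y unfolding X(2) using \<open>finite D\<close> that by simp
  obtain X1 X2 X3 where X123: "X = (X1, X2, X3)" by (cases X)
  have XD: "X1 \<subseteq> V1" "X2 \<subseteq> U" "X3 \<subseteq> V3" using X(1) X123 by (auto simp: D_def)
  have max: "\<Phi> (Y1, Y2, Y3) \<le> \<Phi> (X1, X2, X3)" if "Y1 \<subseteq> V1" "Y2 \<subseteq> U" "Y3 \<subseteq> V3" for Y1 Y2 Y3
    using maxX[of "(Y1, Y2, Y3)"] that unfolding X123 by (simp add: D_def)
  have finX: "finite X1" "finite X2" "finite X3" using XD fin by (auto intro: finite_subset)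
  have spos: "s > 0" using par by simp
  have d1: "A \<le> card {w \<in> X2. u \<in> N1 w}" if u: "u \<in> X1" for u
  proof (rule ccontr)
    assume "\<not> ?thesis"
    then have lt: "int (card {w \<in> X2. u \<in> N1 w}) < int A" by simp
    have "\<Phi> (X1 - {u}, X2, X3) \<le> \<Phi> (X1, X2, X3)" using XD by (intro max) auto
    moreover have e1: "int (card X1) = int (card (X1 - {u})) + 1"
      using card.remove[OF finX(1) u] by linarith
    have e2: "int (\<Sum>w\<in>X2. card (N1 w \<inter> X1)) = int (\<Sum>w\<in>X2. card (N1 w \<inter> (X1 - {u}))) + int (card {w \<in> X2. u \<in> N1 w})"
      by (simp only: sum_card_remove[OF finX(2,1) u, of N1] of_nat_add)
    moreover have "4 * int s * int (card {w \<in> X2. u \<in> N1 w}) < 4 * int s * int A" using lt spos by simp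
    ultimately show False
      unfolding \<Phi>_def prod.case e1 e2 ring_distribs by linarith
  qed
  have d3: "2 * T \<le> card {w \<in> X2. z \<in> N3 w}" if z: "z \<in> X3" for z
  proof (rule ccontr)
    assume "\<not> ?thesis"
    then have lt: "int (card {w \<in> X2. z \<in> N3 w}) < 2 * int T" by simp
    have "\<Phi> (X1, X2, X3 - {z}) \<le> \<Phi> (X1, X2, X3)" using XD by (intro max) auto
    moreover have e1: "int (card X3) = int (card (X3 - {z})) + 1"
      using card.remove[OF finX(3) z] by linarith
    have e2: "int (\<Sum>w\<in>X2. card (N3 w \<inter> X3)) = int (\<Sum>w\<in>X2. card (N3 w \<inter> (X3 - {z}))) + int (card {w \<in> X2. z \<in> N3 w})"
      by (simp only: sum_card_remove[OF finX(2,3) z, of N3] of_nat_add)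
    ultimately show False using lt unfolding \<Phi>_def prod.case e1 e2 ring_distribs by linarith
  qed
  have d2: "b \<le> card (N1 w \<inter> X1) \<and> 2 * s \<le> card (N3 w \<inter> X3)" if w: "w \<in> X2" for w
  proof -
    have wU: "w \<in> U" using w XD by blast
    have fN: "finite (N1 w)" "finite (N3 w)" using N1(1)[OF wU] N3(1)[OF wU] fin by (auto intro: finite_subset)
    have le: "card (N1 w \<inter> X1) \<le> b" "card (N3 w \<inter> X3) \<le> 4 * s"
      using card_mono[OF fN(1), of "N1 w \<inter> X1"] card_mono[OF fN(2), of "N3 w \<inter> X3"] N1(2) N3(2) wU by auto
    have "\<Phi> (X1, X2 - {w}, X3) \<le> \<Phi> (X1, X2, X3)" using XD by (intro max) auto
    moreover have e1: "int (card X2) = int (card (X2 - {w})) + 1"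
      using card.remove[OF finX(2) w] by linarith
    have e2: "int (\<Sum>w\<in>X2. card (N w \<inter> Y)) = int (card (N w \<inter> Y)) + int (\<Sum>w\<in>X2 - {w}. card (N w \<inter> Y))"
      for N :: "'a \<Rightarrow> 'a set" and Y
      unfolding sum.remove[OF finX(2) w] by (rule of_nat_add)
    ultimately have "4 * int s * int b + 2 * int s \<le> 4 * int s * int (card (N1 w \<inter> X1)) + int (card (N3 w \<inter> X3))"
      unfolding \<Phi>_def prod.case e1 e2 ring_distribs by linarith
    then have "int (4 * s * b + 2 * s) \<le> int (4 * s * card (N1 w \<inter> X1) + card (N3 w \<inter> X3))"
      by (simp only: of_nat_mult of_nat_add of_nat_numeral)
    then have key: "4 * s * b + 2 * s \<le> 4 * s * card (N1 w \<inter> X1) + card (N3 w \<inter> X3)"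
      by (simp only: of_nat_le_iff)
    \<comment> \<open>With at most \<open>b - 1\<close> edges to \<open>X1\<close>, even
      \<open>4 * s\<close> edges to \<open>X3\<close> give a weight of only
      \<open>4 * s * b\<close>, which is \<open>2 * s\<close> short of the charge.\<close>
    have "b \<le> card (N1 w \<inter> X1)"
    proof (rule ccontr)
      assume "\<not> ?thesis"
      then have "Suc (card (N1 w \<inter> X1)) \<le> b" by simp
      then have "4 * s * Suc (card (N1 w \<inter> X1)) \<le> 4 * s * b" by (intro mult_le_mono2)
      then show False using key le(2) spos by simp
    qed
    moreover from this have "card (N1 w \<inter> X1) = b" using le(1) by simp
    then have "2 * s \<le> card (N3 w \<inter> X3)" using key by simp
    ultimately show ?thesis by simp
  qed
  define R where "R x y \<longleftrightarrow> x \<in> X2 \<and> y \<in> N1 x \<inter> X1 \<union> N3 x \<inter> X3 \<or> y \<in> X2 \<and> x \<in> N1 y \<inter> X1 \<union> N3 y \<inter> X3" for x y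
  have dX: "X1 \<inter> X2 = {}" "X1 \<inter> X3 = {}" "X2 \<inter> X3 = {}" using XD disj by blast+
  have N1X3: "N1 w \<inter> X3 = {}" and N3X1: "N3 w \<inter> X1 = {}" if "w \<in> X2" for w
    using that N1(1)[of w] N3(1)[of w] XD disj by blast+
  interpret tri: trilayer R X1 X2 X3 k b q T s
  proof
    show "finite X1" "finite X2" "finite X3" by (fact finX)+
    show "X1 \<inter> X2 = {}" "X1 \<inter> X3 = {}" "X2 \<inter> X3 = {}" by (fact dX)+
    show "R y x" if "R x y" for x y using that unfolding R_def by blast
    show "x \<in> X2 \<and> y \<in> X1 \<union> X3 \<or> y \<in> X2 \<and> x \<in> X1 \<union> X3" if "R x y" for x y
      using that unfolding R_def by blast
    show "2 * k * 5 ^ T + k < card {w. R u w}" if "u \<in> X1" for u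
    proof -
      have "{w. R u w} = {w \<in> X2. u \<in> N1 w}" using that dX N3X1 unfolding R_def by blast
      then show ?thesis using d1[OF that] by (simp add: A_def)
    qed
    show "2 * T \<le> card {w. R z w}" if "z \<in> X3" for z
    proof -
      have "{w. R z w} = {w \<in> X2. z \<in> N3 w}" using that dX N1X3 unfolding R_def by blast
      then show ?thesis using d3[OF that] by simp
    qed
    fix w assume w: "w \<in> X2"
    have 1: "{u \<in> X1. R w u} = N1 w \<inter> X1" using w dX N3X1[OF w] unfolding R_def by blast
    have 3: "{z \<in> X3. R w z} = N3 w \<inter> X3" using w dX N1X3[OF w] unfolding R_def by blast
    show "b \<le> card {u \<in> X1. R w u}" "2 * s \<le> card {z \<in> X3. R w z}" using d2[OF w] by (simp_all add: 1 3)
    have wU: "w \<in> U" using w XD by blast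
    have "finite (N3 w)" using N3(1)[OF wU] fin(3) by (auto intro: finite_subset)
    then show "card {z \<in> X3. R w z} \<le> 4 * s"
      using card_mono[of "N3 w" "N3 w \<inter> X3"] N3(2)[OF wU] by (simp add: 3)
  qed (use par in auto)
  have "X2 \<noteq> {}"
  proof
    assume "X2 = {}"
    then have "\<Phi> (X1, X2, X3) = - (4 * int s * int A * int (card X1) + 2 * int T * int (card X3))"
      by (simp add: \<Phi>_def)
    moreover have "0 \<le> 4 * int s * int A * int (card X1) + 2 * int T * int (card X3)"
      by (intro add_nonneg_nonneg mult_nonneg_nonneg) auto
    ultimately have "\<Phi> (X1, X2, X3) \<le> 0" by linarith
    \<comment> \<open>In the full triple each vertex of \<open>U\<close> gains
      \<open>4 * s * b + 4 * s\<close> and is charged \<open>4 * s * b + 2 * s\<close>. The surplus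
      \<open>2 * s * card U\<close> exceeds the other charges by \<open>big\<close>.\<close>
    moreover have "0 < \<Phi> (V1, U, V3)"
    proof -
      have "N1 w \<inter> V1 = N1 w" "N3 w \<inter> V3 = N3 w" if "w \<in> U" for w
        using N1(1)[OF that] N3(1)[OF that] by auto
      then have "(\<Sum>w\<in>U. card (N1 w \<inter> V1)) = card U * b" "(\<Sum>w\<in>U. card (N3 w \<inter> V3)) = card U * (4 * s)"
        using N1(2) N3(2) by simp_all
      then have e: "int (\<Sum>w\<in>U. card (N1 w \<inter> V1)) = int (card U) * int b"
        "int (\<Sum>w\<in>U. card (N3 w \<inter> V3)) = int (card U) * (4 * int s)"
        by (simp_all only: of_nat_mult of_nat_numeral)
      then have "\<Phi> (V1, U, V3) = 2 * int s * int (card U) - 4 * int s * int A * int (card V1) - 2 * int T * int (card V3)"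
        unfolding \<Phi>_def prod.case e by (simp add: algebra_simps)
      moreover have "int (4 * s * A * card V1 + 2 * T * card V3) < int (2 * s * card U)"
        using big unfolding A_def by (simp only: of_nat_less_iff)
      then have "4 * int s * int A * int (card V1) + 2 * int T * int (card V3) < 2 * int s * int (card U)"
        by (simp only: of_nat_mult of_nat_add of_nat_numeral)
      ultimately show ?thesis by linarith
    qed
    ultimately show False using max[of V1 U V3] by simp
  qed
  then obtain w where "w \<in> X2" by blast
  then have "card (N1 w \<inter> X1) \<noteq> 0" using d2[of w] par by auto
  then have "X1 \<noteq> {}" by auto
  then obtain c where c: "tri.well_placed c" using tri.well_placed_theta by blast
  have N_E: "E w y" if "w \<in> X2" "y \<in> N1 w \<inter> X1 \<union> N3 w \<inter> X3" for w y
    using that N1(1)[of w] N3(1)[of w] XD(2) by blast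
  have RE: "E x y" if "R x y" for x y
    using that N_E[of x y] sym[OF N_E[of y x]] unfolding R_def by blast
  have "theta E k c" using c RE theta_mono unfolding tri.well_placed_def by blast
  moreover have cX: "set c \<subseteq> X1 \<union> X2 \<union> X3" using c by (simp add: tri.well_placed_def)
  moreover have "\<exists>u\<in>V1 - set c. E v u" if "v \<in> set c \<inter> U" for v
  proof -
    have "v \<in> set c \<inter> X2" using that cX XD disj by blast
    then obtain u where "u \<in> X1 - set c" "R v u" using c unfolding tri.well_placed_def by blast
    then show ?thesis using XD RE by blast
  qed
  ultimately show ?thesis using XD by blast
qed

text \<open>With about \<open>d * card V1\<close> edges between \<open>V1\<close> and
  \<open>V2\<close> and \<open>s\<close> about \<open>d / 8\<close>, this says that two layers gain
  a factor of order \<open>d\<^sup>2 / (k * ln k)\<close>. Cutting off degrees above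
  \<open>4 * k\<close> keeps the harmonic sum logarithmic in \<open>k\<close> and leaves each
  remaining vertex \<open>4 * s\<close> edges to \<open>V3\<close>.\<close>

lemma two_layer_growth:
  fixes E :: "'a \<Rightarrow> 'a \<Rightarrow> bool" and k d d1 s A :: nat
  assumes fin: "finite V1" "finite V2" "finite V3"
    and disj: "V1 \<inter> V2 = {}" "V1 \<inter> V3 = {}" "V2 \<inter> V3 = {}"
    and sym: "\<And>x y. E x y \<Longrightarrow> E y x" and bip: "\<And>x y. E x y \<Longrightarrow> x \<in> S \<longleftrightarrow> y \<notin> S"
    and none: "\<And>c. theta E k c \<Longrightarrow> set c \<subseteq> V1 \<union> V2 \<union> V3 \<Longrightarrow> \<exists>v\<in>set c \<inter> V2. \<forall>u\<in>V1 - set c. \<not> E v u"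
    and sparse: "\<And>U. U \<subseteq> V2 \<Longrightarrow> (\<Sum>w\<in>U. card {u \<in> V1. E w u}) \<le> k * (card V1 + card U)"
    and deg: "\<And>w. w \<in> V2 \<Longrightarrow> d \<le> card {u \<in> V1. E w u} + card {z \<in> V3. E w z}"
    and k: "2 \<le> k" and s: "k < s" "8 * s \<le> d"
  defines "A \<equiv> 2 * k * 5 ^ k + k + 1"
  shows "2 * real s * (real (\<Sum>w\<in>V2. card {u \<in> V1. E w u}) - (2 * real k + 8 * real k * real A) * real (card V1))
           \<le> 8 * real k * (2 + ln (4 * real k)) * real (card V3)"
proof -
  define dg where "dg w = card {u \<in> V1. E w u}" for w
  define L where "L = {w \<in> V2. dg w \<le> 4 * k}"
  define H where "H = {w \<in> V2. 4 * k < dg w}"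
  have finLH: "finite L" "finite H" using fin by (auto simp: L_def H_def)
  \<comment> \<open>In \<open>k * (card V1 + card H)\<close> the second summand is at most a quarter
    of the edges at \<open>H\<close>, so it can be absorbed.\<close>
  have H: "(\<Sum>w\<in>H. dg w) \<le> 2 * k * card V1"
  proof -
    have "card H * (4 * k) = (\<Sum>w\<in>H. 4 * k)" by simp
    also have "\<dots> \<le> (\<Sum>w\<in>H. dg w)" by (intro sum_mono) (auto simp: H_def)
    finally have "card H * (4 * k) \<le> (\<Sum>w\<in>H. dg w)" .
    moreover have "(\<Sum>w\<in>H. dg w) \<le> k * (card V1 + card H)"
      unfolding dg_def by (intro sparse) (auto simp: H_def)
    ultimately have *: "4 * (k * card H) \<le> (\<Sum>w\<in>H. dg w)" "(\<Sum>w\<in>H. dg w) \<le> k * card V1 + k * card H"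
      by (simp_all add: algebra_simps)
    then show ?thesis by linarith
  qed
  define U where "U b = {w \<in> L. b \<le> dg w}" for b
  have UV: "U b \<subseteq> V2" "finite (U b)" for b using fin by (auto simp: U_def L_def)
  have fwd: "4 * s \<le> card {z \<in> V3. E w z}" if "w \<in> L" for w
  proof -
    have "d \<le> dg w + card {z \<in> V3. E w z}" "dg w \<le> 4 * k" using that deg[of w] by (auto simp: L_def dg_def)
    then show ?thesis using s by linarith
  qed
  have Ub: "2 * real s * real (card (U b)) \<le> 4 * real s * real A * real (card V1) + (8 * real k / real b + 2) * real (card V3)"
    if b: "1 \<le> b" for b
  proof (cases "b < 8")
    case True
    \<comment> \<open>For small \<open>b\<close> there need not be a \<open>q \<ge> 3\<close> with
      \<open>2 * q \<le> b\<close>. But a theta graph between \<open>U b\<close> and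
      \<open>V3\<close> misses \<open>V1\<close>, so one neighbour in \<open>V1\<close> for each
      vertex of \<open>U b\<close> makes it well placed. The bound so obtained fits because
      \<open>8 * k / b \<ge> k\<close>.\<close>
    have "(\<Sum>w\<in>U b. card {z \<in> V3. E w z}) \<le> k * (card (U b) + card V3)"
    proof (rule ccontr)
      assume "\<not> ?thesis"
      then have "\<exists>c. theta E k c \<and> set c \<subseteq> U b \<union> V3"
        using UV[of b] fin disj k by (intro theta_dense[OF _ _ _ _ sym bip]) auto
      then obtain c where c: "theta E k c" "set c \<subseteq> U b \<union> V3" by blast
      then obtain v where v: "v \<in> set c \<inter> V2" "\<forall>u\<in>V1 - set c. \<not> E v u" using none[of c] UV[of b] by blast
      have "v \<in> U b" using v c(2) disj by blast
      then have "card {u \<in> V1. E v u} \<noteq> 0" using b by (auto simp: U_def dg_def)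
      then have "{u \<in> V1. E v u} \<noteq> {}" by (metis card.empty)
      moreover have "V1 \<inter> set c = {}" using c(2) UV[of b] disj by blast
      ultimately show False using v(2) by blast
    qed
    moreover have "card (U b) * (4 * s) \<le> (\<Sum>w\<in>U b. card {z \<in> V3. E w z})"
    proof -
      have "card (U b) * (4 * s) = (\<Sum>w\<in>U b. 4 * s)" by simp
      also have "\<dots> \<le> (\<Sum>w\<in>U b. card {z \<in> V3. E w z})" using fwd by (intro sum_mono) (auto simp: U_def)
      finally show ?thesis .
    qed
    ultimately have "4 * (s * card (U b)) \<le> k * card (U b) + k * card V3" by (simp add: algebra_simps)
    moreover have "k * card (U b) \<le> s * card (U b)" using s by (intro mult_le_mono1) simp
    ultimately have "2 * (s * card (U b)) \<le> k * card V3" by linarith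
    then have "real (2 * (s * card (U b))) \<le> real (k * card V3)" by (simp only: of_nat_le_iff)
    moreover have "real k * real (card V3) \<le> (8 * real k / real b + 2) * real (card V3)"
    proof (rule mult_right_mono)
      have "real k * real b \<le> real k * 8" using True by (intro mult_left_mono) auto
      then show "real k \<le> 8 * real k / real b + 2" using b by (simp add: field_simps)
    qed simp
    moreover have "0 \<le> 4 * real s * real A * real (card V1)" by simp
    ultimately show ?thesis unfolding of_nat_mult of_nat_numeral mult.assoc by linarith
  next
    case False
    define q where "q = b div 2"
    \<comment> \<open>About the smallest \<open>T\<close> with
      \<open>k \<le> Suc (T * (q - 1))\<close>, since \<open>T\<close> is the price of a vertex of
      \<open>V3\<close>. By \<open>b \<le> 4 * (q - 1)\<close> it is at most
      \<open>4 * k / b + 1\<close>, and \<open>T \<le> k\<close> lets one constant \<open>A\<close>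
      serve for all \<open>b\<close>.\<close>
    define T where "T = (k - 1) div (q - 1) + 1"
    have q: "3 \<le> q" "2 * q \<le> b" "b \<le> 2 * q + 1" using False by (auto simp: q_def)
    have "T * (q - 1) = (q - 1) + (k - 1) div (q - 1) * (q - 1)"
      unfolding T_def distrib_right mult_1 by (rule add.commute)
    moreover have "k - 1 < (q - 1) + (k - 1) div (q - 1) * (q - 1)"
      using q by (intro dividend_less_div_times) simp
    ultimately have "k - 1 < T * (q - 1)" by (simp only:)
    then have kT: "k \<le> Suc (T * (q - 1))" by linarith
    have "(k - 1) div (q - 1) \<le> k - 1" by (rule div_le_dividend)
    then have Tk: "T \<le> k" using k unfolding T_def by linarith
    have "\<not> (4 * s * (2 * k * 5 ^ T + k + 1) * card V1 + 2 * T * card V3 < 2 * s * card (U b))"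
    proof
      assume *: "4 * s * (2 * k * 5 ^ T + k + 1) * card V1 + 2 * T * card V3 < 2 * s * card (U b)"
      have "\<exists>c. theta E k c \<and> set c \<subseteq> V1 \<union> U b \<union> V3 \<and> (\<forall>v\<in>set c \<inter> U b. \<exists>u\<in>V1 - set c. E v u)"
      proof (rule trilayer_theta[OF fin(1) UV(2) fin(3) _ disj(2) _ sym k s(1) _ q(1,2) kT _ _ *])
        show "V1 \<inter> U b = {}" "U b \<inter> V3 = {}" using UV[of b] disj by blast+
        show "1 \<le> T" by (simp add: T_def)
        show "b \<le> card {u \<in> V1. E w u}" if "w \<in> U b" for w using that by (simp add: U_def dg_def)
        show "4 * s \<le> card {z \<in> V3. E w z}" if "w \<in> U b" for w using that fwd by (simp add: U_def)
      qed
      then obtain c where c: "theta E k c" "set c \<subseteq> V1 \<union> U b \<union> V3"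
        "\<And>v. v \<in> set c \<inter> U b \<Longrightarrow> \<exists>u\<in>V1 - set c. E v u" by blast
      moreover have "set c \<inter> V2 \<subseteq> U b" using c(2) disj by blast
      ultimately show False using none[of c] UV(1)[of b] by blast
    qed
    then have "2 * s * card (U b) \<le> 4 * s * (2 * k * 5 ^ T + k + 1) * card V1 + 2 * T * card V3" by simp
    also have "\<dots> \<le> 4 * s * A * card V1 + 2 * T * card V3"
      unfolding A_def using Tk by (intro add_mono mult_le_mono power_increasing) auto
    finally have "real (2 * s * card (U b)) \<le> real (4 * s * A * card V1 + 2 * T * card V3)" by (simp only: of_nat_le_iff)
    then have le: "2 * real s * real (card (U b)) \<le> 4 * real s * real A * real (card V1) + 2 * real T * real (card V3)"
      by simp
    have "real T \<le> real (k - 1) / real (q - 1) + 1"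
      unfolding T_def using of_nat_div_le_of_nat[of "k - 1" "q - 1", where 'a = real] by simp
    moreover have "real (k - 1) / real (q - 1) \<le> 4 * real k / real b"
    proof -
      have "b \<le> 4 * (q - 1)" using q False by linarith
      then have "real b \<le> 4 * real (q - 1)" by linarith
      then have "real (k - 1) * real b \<le> real k * (4 * real (q - 1))" by (intro mult_mono) auto
      then show ?thesis using q b by (simp add: field_simps)
    qed
    ultimately have "2 * real T \<le> 8 * real k / real b + 2" by simp
    then have "2 * real T * real (card V3) \<le> (8 * real k / real b + 2) * real (card V3)"
      by (rule mult_right_mono) simp
    then show ?thesis using le by simp
  qed
  have Lsum: "(\<Sum>w\<in>L. dg w) = (\<Sum>b\<in>{1..4 * k}. card (U b))"
  proof -
    have "(\<Sum>w\<in>L. dg w) = (\<Sum>w\<in>L. card {b \<in> {1..4 * k}. b \<le> dg w})"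
    proof (rule sum.cong[OF refl])
      fix w assume "w \<in> L"
      then have "{b \<in> {1..4 * k}. b \<le> dg w} = {1..dg w}" by (auto simp: L_def)
      then show "dg w = card {b \<in> {1..4 * k}. b \<le> dg w}" by simp
    qed
    also have "\<dots> = (\<Sum>b\<in>{1..4 * k}. card {w \<in> L. b \<le> dg w})" using finLH by (intro sum_card_swap) auto
    finally show ?thesis by (simp add: U_def)
  qed
  have harm: "(\<Sum>b\<in>{1..4 * k}. 8 * real k / real b + 2) \<le> 8 * real k * (2 + ln (4 * real k))"
  proof -
    have "(\<Sum>b\<in>{1..4 * k}. 8 * real k / real b + 2) = 8 * real k * harm (4 * k) + 8 * real k"
      by (simp add: sum.distrib harm_def sum_distrib_left divide_inverse)
    \<comment> \<open>The sequence \<open>harm n - ln n\<close> decreases from its first value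
      1.\<close>
    moreover have "harm (4 * k) \<le> 1 + ln (real (4 * k))"
      using k euler_mascheroni_sequence_decreasing[of 1 "4 * k"] by (simp add: harm_def)
    then have "8 * real k * harm (4 * k) \<le> 8 * real k * (1 + ln (4 * real k))" by (intro mult_left_mono) auto
    ultimately show ?thesis by (simp add: algebra_simps)
  qed
  have "2 * real s * real (\<Sum>w\<in>L. dg w) = (\<Sum>b\<in>{1..4 * k}. 2 * real s * real (card (U b)))"
    by (simp add: Lsum sum_distrib_left)
  also have "\<dots> \<le> (\<Sum>b\<in>{1..4 * k}. 4 * real s * real A * real (card V1) + (8 * real k / real b + 2) * real (card V3))"
    by (intro sum_mono Ub) auto
  also have "\<dots> = 16 * real k * real s * real A * real (card V1) + (\<Sum>b\<in>{1..4 * k}. 8 * real k / real b + 2) * real (card V3)"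
    unfolding sum.distrib sum_distrib_right[symmetric] by simp
  also have "\<dots> \<le> 16 * real k * real s * real A * real (card V1) + 8 * real k * (2 + ln (4 * real k)) * real (card V3)"
    by (intro add_left_mono mult_right_mono harm) simp
  finally have Lb: "2 * real s * real (\<Sum>w\<in>L. dg w)
    \<le> 16 * real k * real s * real A * real (card V1) + 8 * real k * (2 + ln (4 * real k)) * real (card V3)" .
  have "V2 = L \<union> H" "L \<inter> H = {}" by (auto simp: L_def H_def)
  then have "(\<Sum>w\<in>V2. dg w) = (\<Sum>w\<in>L. dg w) + (\<Sum>w\<in>H. dg w)" using finLH by (simp add: sum.union_disjoint)
  then have "(\<Sum>w\<in>V2. dg w) \<le> (\<Sum>w\<in>L. dg w) + 2 * k * card V1" using H by simp
  then have "real (\<Sum>w\<in>V2. dg w) \<le> real ((\<Sum>w\<in>L. dg w) + 2 * k * card V1)" by (simp only: of_nat_le_iff)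
  then have "real (\<Sum>w\<in>V2. dg w) - 2 * real k * real (card V1) \<le> real (\<Sum>w\<in>L. dg w)" by simp
  then have "2 * real s * (real (\<Sum>w\<in>V2. dg w) - 2 * real k * real (card V1)) \<le> 2 * real s * real (\<Sum>w\<in>L. dg w)"
    by (intro mult_left_mono) auto
  then show ?thesis using Lb unfolding dg_def by (simp add: algebra_simps)
qed

section \<open>Distance layers and their growth\<close>

primrec reach :: "('a \<Rightarrow> 'a \<Rightarrow> bool) \<Rightarrow> 'a \<Rightarrow> nat \<Rightarrow> 'a set" where
  "reach E x 0 = {x}"
| "reach E x (Suc n) = reach E x n \<union> {y. \<exists>u\<in>reach E x n. E u y}"

definition layer :: "('a \<Rightarrow> 'a \<Rightarrow> bool) \<Rightarrow> 'a \<Rightarrow> nat \<Rightarrow> 'a set" where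
  "layer E x n = reach E x n - (\<Union>j<n. reach E x j)"

lemma layer_0: "layer E x 0 = {x}"
  by (simp add: layer_def)

lemma layer_disjoint: "i \<noteq> j \<Longrightarrow> layer E x i \<inter> layer E x j = {}"
  by (cases i j rule: linorder_cases) (auto simp: layer_def)

lemma layer_down:
  assumes "v \<in> layer E x (Suc j)"
  shows "\<exists>u\<in>layer E x j. E u v"
proof -
  from assms have v: "v \<in> reach E x (Suc j)" "\<And>i. i < Suc j \<Longrightarrow> v \<notin> reach E x i"
    by (auto simp: layer_def)
  then obtain u where u: "u \<in> reach E x j" "E u v" using v(2)[of j] by auto
  have "u \<notin> reach E x i" if "i < j" for i
    using v(2)[of "Suc i"] that u(2) by auto
  then show ?thesis using u by (auto simp: layer_def)
qed

lemma layer_nbr: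
  assumes sym: "\<And>x y. E x y \<Longrightarrow> E y x" and v: "v \<in> layer E x j" "E v z"
  shows "z \<in> layer E x (j - 1) \<union> layer E x j \<union> layer E x (Suc j)"
proof -
  have vj: "v \<in> reach E x j" "\<And>i. i < j \<Longrightarrow> v \<notin> reach E x i" using v by (auto simp: layer_def)
  have "z \<in> reach E x (Suc j)" using vj(1) v(2) by auto
  define i where "i = (LEAST i. z \<in> reach E x i)"
  have i: "z \<in> reach E x i" "i \<le> Suc j" "\<And>i'. i' < i \<Longrightarrow> z \<notin> reach E x i'"
    unfolding i_def
    by (rule LeastI[of "\<lambda>i. z \<in> reach E x i", OF \<open>z \<in> reach E x (Suc j)\<close>],
        rule Least_le[of "\<lambda>i. z \<in> reach E x i", OF \<open>z \<in> reach E x (Suc j)\<close>], rule not_less_Least)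
  then have "z \<in> layer E x i" by (auto simp: layer_def)
  have "v \<in> reach E x (Suc i)" using i(1) sym[OF v(2)] by auto
  then have "\<not> Suc i < j" using vj(2) by blast
  then have "i = j - 1 \<or> i = j \<or> i = Suc j" using i(2) by linarith
  then show ?thesis using \<open>z \<in> layer E x i\<close> by auto
qed

lemma layer_parity:
  assumes bip: "\<And>x y. E x y \<Longrightarrow> x \<in> S \<longleftrightarrow> y \<notin> S"
  shows "v \<in> layer E x j \<Longrightarrow> v \<in> S \<longleftrightarrow> (x \<in> S \<longleftrightarrow> even j)"
proof (induction j arbitrary: v)
  case 0
  then show ?case by (simp add: layer_0)
next
  case (Suc j)
  then obtain u where "u \<in> layer E x j" "E u v" using layer_down by metis
  then show ?case using Suc.IH[of u] bip[of u v] by auto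
qed

text \<open>\<open>N\<close> stands for the \<open>k\<close>-th root of the order of the whole
  graph. The hypothesis \<open>growth\<close> is what turns \<open>two_layer_growth\<close> with
  \<open>s = d div 8\<close> into a gain of \<open>N\<^sup>2\<close> over two layers.\<close>

lemma bipartite_min_degree_cycle:
  fixes E :: "'a \<Rightarrow> 'a \<Rightarrow> bool" and k d :: nat and N :: real
  assumes fin: "finite V" and x0: "x0 \<in> V"
    and sym: "\<And>x y. E x y \<Longrightarrow> E y x" and bip: "\<And>x y. E x y \<Longrightarrow> x \<in> S \<longleftrightarrow> y \<notin> S"
    and EV: "\<And>x y. E x y \<Longrightarrow> x \<in> V" and deg: "\<And>x. x \<in> V \<Longrightarrow> d \<le> card {y. E x y}"
    and k: "2 \<le> k" and s: "k < d div 8" and N: "0 \<le> N" "N \<le> real d" "real (card V) \<le> N ^ k"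
    and growth: "N\<^sup>2 * (8 * real k * (2 + ln (4 * real k)))
      \<le> 2 * real (d div 8) * (real d - 4 * real k - 8 * real k * real (2 * k * 5 ^ k + k + 1))"
  shows "\<exists>xs. length xs = 2 * k \<and> distinct xs \<and> successively E xs \<and> E (last xs) (hd xs)"
proof (rule ccontr)
  assume nocycle: "\<not> ?thesis"
  define L where "L = layer E x0"
  define A where "A = 2 * k * 5 ^ k + k + 1"
  have EV': "y \<in> V" if "E x y" for x y using EV[OF sym[OF that]] .
  have L0: "L 0 = {x0}" by (simp add: L_def layer_0)
  have disj: "L i \<inter> L j = {}" if "i \<noteq> j" for i j unfolding L_def using that by (rule layer_disjoint)
  have down: "\<exists>u\<in>L j. E u v" if "v \<in> L (Suc j)" for v j using that layer_down unfolding L_def by metis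
  have LV: "L j \<subseteq> V" for j
  proof (cases j)
    case (Suc j')
    then show ?thesis using down[of _ j'] EV' by blast
  qed (use x0 L0 in simp)
  have finL: "finite (L j)" for j using LV fin by (rule finite_subset)
  define S' where "S' = (if x0 \<in> S then S else - S)"
  have bip': "x \<in> S' \<longleftrightarrow> y \<notin> S'" if "E x y" for x y using bip[OF that] by (auto simp: S'_def)
  have LS: "v \<in> S' \<longleftrightarrow> even j" if "v \<in> L j" for v j
    using layer_parity[where E = E and S = S and v = v and x = x0 and j = j] bip that by (auto simp: S'_def L_def)
  have none: "\<exists>v\<in>set c \<inter> L i. \<forall>u\<in>L (i - 1) - set c. \<not> E v u"
    if "theta E k c" "set c \<subseteq> L (i - 1) \<union> L i \<union> L (Suc i)" "1 \<le> i" "i < k" for c i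
  proof (rule ccontr)
    assume "\<not> ?thesis"
    then have wp: "\<exists>u\<in>L (i - 1) - set c. E u v" if "v \<in> set c \<inter> L i" for v using that sym by blast
    show False using nocycle theta_in_layers_cycle[OF sym bip' k that(1,3,4) L0 disj down LS that(2) wp] by blast
  qed
  define e where "e i = (\<Sum>w\<in>L (Suc i). card {u \<in> L i. E w u})" for i
  \<comment> \<open>A theta graph between \<open>L i\<close> and \<open>L (Suc i)\<close> is well
    placed with \<open>L i\<close> in the middle: it misses \<open>L (i - 1)\<close>, where every
    vertex of \<open>L i\<close> has a neighbour. At \<open>i = 0\<close> no layer lies above, but
    then a vertex has at most one neighbour in \<open>L i\<close>.\<close>
  have sparse: "(\<Sum>w\<in>U. card {u \<in> L i. E w u}) \<le> k * (card (L i) + card U)" if US: "U \<subseteq> L (Suc i)" and ik: "i < k" for U i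
  proof (cases "i = 0")
    case True
    have "card {u \<in> L i. E w u} \<le> 1" for w
    proof -
      have "card {u \<in> L i. E w u} \<le> card {x0}" using True L0 by (intro card_mono) auto
      then show ?thesis by simp
    qed
    then have "(\<Sum>w\<in>U. card {u \<in> L i. E w u}) \<le> (\<Sum>w\<in>U. 1)" by (rule sum_mono)
    also have "\<dots> \<le> 1 * (card (L i) + card U)" by simp
    also have "\<dots> \<le> k * (card (L i) + card U)" using k by (intro mult_le_mono1) simp
    finally show ?thesis .
  next
    case False
    show ?thesis
    proof (rule ccontr)
      assume "\<not> ?thesis"
      then have dense: "k * (card U + card (L i)) < (\<Sum>w\<in>U. card {u \<in> L i. E w u})" by (simp add: add.commute)
      have "finite U" using US finL by (rule finite_subset)
      moreover have "U \<inter> L i = {}" using US disj[of "Suc i" i] by auto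
      ultimately obtain c where c: "theta E k c" "set c \<subseteq> U \<union> L i"
        using theta_dense[OF _ finL _ k sym bip dense] by blast
      have "set c \<subseteq> L (i - 1) \<union> L i \<union> L (Suc i)" using c(2) US by blast
      moreover have i1: "1 \<le> i" "Suc (i - 1) = i" using False by auto
      ultimately obtain v where v: "v \<in> set c \<inter> L i" "\<forall>u\<in>L (i - 1) - set c. \<not> E v u"
        using none[OF c(1) _ _ ik] by blast
      obtain u where u: "u \<in> L (i - 1)" "E u v" using down[of v "i - 1"] v(1) unfolding i1(2) by blast
      have "L (i - 1) \<inter> L i = {}" "L (i - 1) \<inter> L (Suc i) = {}" using i1 by (simp_all add: disj)
      then have "u \<notin> set c" using u(1) c(2) US by blast
      then show False using u v(2) sym by blast
    qed
  qed
  have nbrs: "card {y. E v y} = card {u \<in> L j. E v u} + card {z \<in> L (Suc (Suc j)). E v z}" if v: "v \<in> L (Suc j)" for v j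
  proof -
    have "z \<in> L j \<union> L (Suc (Suc j))" if "E v z" for z
    proof -
      have "z \<notin> L (Suc j)" using LS[OF v] LS[of z "Suc j"] bip'[OF that] by auto
      then show ?thesis using layer_nbr[where E = E and x = x0 and v = v and j = "Suc j" and z = z] sym v that by (auto simp: L_def)
    qed
    then have eq: "{y. E v y} = {u \<in> L j. E v u} \<union> {z \<in> L (Suc (Suc j)). E v z}" by blast
    have "{u \<in> L j. E v u} \<inter> {z \<in> L (Suc (Suc j)). E v z} = {}" using disj[of j "Suc (Suc j)"] by auto
    then show ?thesis unfolding eq by (intro card_Un_disjoint finite_Collect_conjI disjI1) (simp_all add: finL)
  qed
  have d8: "8 * k < d" using s by linarith
  have e_swap: "e i = (\<Sum>u\<in>L i. card {w \<in> L (Suc i). E u w})" for i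
  proof -
    have "e i = (\<Sum>u\<in>L i. card {w \<in> L (Suc i). E w u})" unfolding e_def using finL by (intro sum_card_swap)
    moreover have "{w \<in> L (Suc i). E w u} = {w \<in> L (Suc i). E u w}" for u using sym by blast
    ultimately show ?thesis by simp
  qed
  have L1: "d \<le> card {w \<in> L 1. E x0 w}"
  proof -
    have "w \<in> L 1" if "E x0 w" for w
    proof -
      have "w \<in> L 0 \<union> L 1" using layer_nbr[where E = E and x = x0 and v = x0 and j = 0 and z = w] sym that by (auto simp: L_def layer_0)
      moreover have "w \<noteq> x0" using bip[OF that] by auto
      ultimately show ?thesis using L0 by auto
    qed
    then have "{w \<in> L 1. E x0 w} = {w. E x0 w}" by auto
    then show ?thesis using deg[OF x0] by simp
  qed
  \<comment> \<open>The two parts go together: by \<open>sparse\<close>, the edges from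
    \<open>L (Suc i)\<close> up to \<open>L i\<close> are few compared with
    \<open>d * card (L (Suc i))\<close> because the layers have not shrunk, and the many edges that
    must then go down keep the next layer from shrinking.\<close>
  have grow: "card (L i) \<le> card (L (Suc i)) \<and> d * card (L i) \<le> e i + 2 * k * card (L i)" if "i < k" for i
    using that
  proof (induction i)
    case 0
    have "card {w \<in> L 1. E x0 w} \<le> card (L 1)" using finL by (intro card_mono) auto
    then show ?case using L1 d8 k L0 e_swap[of 0] by simp
  next
    case (Suc i)
    have "d * card (L (Suc i)) = (\<Sum>v\<in>L (Suc i). d)" by simp
    also have "\<dots> \<le> (\<Sum>v\<in>L (Suc i). card {u \<in> L i. E v u} + card {z \<in> L (Suc (Suc i)). E v z})"
    proof (rule sum_mono)
      fix v assume "v \<in> L (Suc i)"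
      then show "d \<le> card {u \<in> L i. E v u} + card {z \<in> L (Suc (Suc i)). E v z}"
        using deg[of v] LV nbrs by auto
    qed
    also have "\<dots> = e i + e (Suc i)" by (simp add: sum.distrib e_def[of i] e_swap[of "Suc i"])
    finally have sum: "d * card (L (Suc i)) \<le> e i + e (Suc i)" .
    have "e i \<le> k * (card (L i) + card (L (Suc i)))" unfolding e_def using Suc.prems by (intro sparse) auto
    also have "\<dots> \<le> k * (card (L (Suc i)) + card (L (Suc i)))" using Suc by (intro mult_le_mono2 add_mono) auto
    also have "\<dots> = 2 * k * card (L (Suc i))" by (simp add: algebra_simps)
    finally have ei: "e i \<le> 2 * k * card (L (Suc i))" .
    have "e (Suc i) \<le> k * (card (L (Suc i)) + card (L (Suc (Suc i))))"
      unfolding e_def using Suc.prems by (intro sparse) auto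
    then have "d * card (L (Suc i)) \<le> 3 * (k * card (L (Suc i))) + k * card (L (Suc (Suc i)))"
      using sum ei by (simp add: algebra_simps)
    moreover have "8 * k * card (L (Suc i)) \<le> d * card (L (Suc i))" using d8 by (intro mult_le_mono1) simp
    ultimately have "k * card (L (Suc i)) \<le> k * card (L (Suc (Suc i)))" by linarith
    then have "card (L (Suc i)) \<le> card (L (Suc (Suc i)))" using k by simp
    then show ?case using sum ei by linarith
  qed
  define K where "K = 8 * real k * (2 + ln (4 * real k))"
  have Kpos: "K > 0" unfolding K_def using k by (intro mult_pos_pos add_pos_nonneg) auto
  have two: "N\<^sup>2 * real (card (L i)) \<le> real (card (L (Suc (Suc i))))" if "Suc i < k" for i
  proof -
    have "2 * real (d div 8) * (real (e i) - (2 * real k + 8 * real k * real A) * real (card (L i)))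
        \<le> K * real (card (L (Suc (Suc i))))"
      unfolding K_def A_def e_def
    proof (rule two_layer_growth[OF finL finL finL _ _ _ sym bip])
      show "L i \<inter> L (Suc i) = {}" "L i \<inter> L (Suc (Suc i)) = {}" "L (Suc i) \<inter> L (Suc (Suc i)) = {}"
        using disj by simp_all
      show "\<exists>v\<in>set c \<inter> L (Suc i). \<forall>u\<in>L i - set c. \<not> E v u"
        if "theta E k c" "set c \<subseteq> L i \<union> L (Suc i) \<union> L (Suc (Suc i))" for c
        using none[of c "Suc i"] that \<open>Suc i < k\<close> by simp
      show "d \<le> card {u \<in> L i. E w u} + card {z \<in> L (Suc (Suc i)). E w z}" if "w \<in> L (Suc i)" for w
        using nbrs[OF that] deg[of w] LV that by auto
      show "(\<Sum>w\<in>U. card {u \<in> L i. E w u}) \<le> k * (card (L i) + card U)" if "U \<subseteq> L (Suc i)" for U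
        using sparse[OF that] \<open>Suc i < k\<close> by simp
    qed (use k s in auto)
    moreover have "real d * real (card (L i)) \<le> real (e i) + 2 * real k * real (card (L i))"
    proof -
      have "real (d * card (L i)) \<le> real (e i + 2 * k * card (L i))"
        using grow[of i] that by (simp only: of_nat_le_iff)
      then show ?thesis by simp
    qed
    then have "2 * real (d div 8) * ((real d - 4 * real k - 8 * real k * real A) * real (card (L i)))
        \<le> 2 * real (d div 8) * (real (e i) - (2 * real k + 8 * real k * real A) * real (card (L i)))"
      by (intro mult_left_mono) (auto simp: algebra_simps)
    moreover have "(N\<^sup>2 * K) * real (card (L i))
        \<le> 2 * real (d div 8) * (real d - 4 * real k - 8 * real k * real A) * real (card (L i))"
      using growth unfolding K_def A_def by (rule mult_right_mono) simp
    ultimately have "K * (N\<^sup>2 * real (card (L i))) \<le> K * real (card (L (Suc (Suc i))))"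
      by (simp add: algebra_simps)
    then show ?thesis using Kpos by simp
  qed
  \<comment> \<open>Two consecutive layers are carried along because the gain comes over two steps;
    \<open>N \<le> d\<close> starts the odd layers.\<close>
  have "N ^ i \<le> real (card (L i)) \<and> (Suc i \<le> k \<longrightarrow> N ^ Suc i \<le> real (card (L (Suc i))))" if "i \<le> k" for i
    using that
  proof (induction i)
    case 0
    have "card {w \<in> L 1. E x0 w} \<le> card (L 1)" using finL by (intro card_mono) auto
    then have "real d \<le> real (card (L 1))" using L1 by simp
    then show ?case using L0 N(2) by simp
  next
    case (Suc i)
    have "N ^ Suc (Suc i) \<le> real (card (L (Suc (Suc i))))" if "Suc (Suc i) \<le> k"
    proof -
      have "N ^ Suc (Suc i) = N\<^sup>2 * N ^ i" by (simp add: power2_eq_square)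
      also have "\<dots> \<le> N\<^sup>2 * real (card (L i))" using Suc by (intro mult_left_mono) auto
      also have "\<dots> \<le> real (card (L (Suc (Suc i))))" using two that by simp
      finally show ?thesis .
    qed
    then show ?case using Suc by simp
  qed
  then have "N ^ k \<le> real (card (L k))" by blast
  \<comment> \<open>\<open>card V\<close> may equal \<open>N ^ k\<close>; the root, which is missing
    from \<open>L k\<close>, makes the contradiction strict.\<close>
  moreover have "L k \<subseteq> V - {x0}" using LV disj[of k 0] L0 k by auto
  then have "card (L k) < card V" using fin x0 psubset_card_mono[of V "L k"] by blast
  ultimately show False using N(3) by linarith
qed

text \<open>In a cut with the most crossing edges, a vertex with more neighbours on its own side
  than on the other could be moved across with profit.\<close>

lemma max_cut:
  assumes fin: "finite A" and sym: "\<And>x y. E x y \<Longrightarrow> E y x" and irr: "\<And>x. \<not> E x x"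
  shows "\<exists>S. \<forall>x\<in>A. card {y \<in> A. E x y} \<le> 2 * card {y \<in> A. E x y \<and> (x \<in> S \<longleftrightarrow> y \<notin> S)}"
proof -
  define f where "f S = (\<Sum>x\<in>S. card {y \<in> A - S. E x y})" for S
  have "Max (f ` Pow A) \<in> f ` Pow A" using fin by (intro Max_in) auto
  then obtain S where S: "S \<subseteq> A" "f S = Max (f ` Pow A)" by auto
  have max: "f T \<le> f S" if "T \<subseteq> A" for T unfolding S(2) using fin that by simp
  have compl: "f (A - T) = f T" if "T \<subseteq> A" for T
  proof -
    have "finite T" using that fin by (rule finite_subset)
    have "A - (A - T) = T" using that by auto
    then have "f (A - T) = (\<Sum>x\<in>A - T. card {y \<in> T. E x y})" by (simp add: f_def)
    also have "\<dots> = (\<Sum>y\<in>T. card {x \<in> A - T. E x y})" using fin \<open>finite T\<close> by (intro sum_card_swap) auto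
    also have "\<dots> = f T" unfolding f_def using sym by (intro sum.cong arg_cong[of _ _ card]) auto
    finally show ?thesis .
  qed
  \<comment> \<open>Stated for \<open>T\<close> instead of \<open>S\<close> so that it applies to
    both sides of the cut: \<open>compl\<close> gives the complement the same number of crossing
    edges.\<close>
  have local_max: "card {y \<in> T. E x y} \<le> card {y \<in> A - T. E x y}" if T: "T \<subseteq> A" "f T = f S" and x: "x \<in> T" for T x
  proof -
    have fT: "finite T" using T fin by (auto intro: finite_subset)
    define B where "B = T - {x}"
    have B: "T = insert x B" "x \<notin> B" "finite B" using x fT by (auto simp: B_def)
    have "card {y \<in> A - B. E u y} = card {y \<in> A - T. E u y} + (if E u x then 1 else 0)" for u
    proof -
      have "{y \<in> A - B. E u y} = (if E u x then insert x {y \<in> A - T. E u y} else {y \<in> A - T. E u y})"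
        using B T x by auto
      then show ?thesis using fin x by simp
    qed
    then have "f B = (\<Sum>u\<in>B. card {y \<in> A - T. E u y}) + card {u \<in> B. E u x}"
      unfolding f_def using B(3) by (simp add: sum.distrib sum.If_cases Int_def)
    moreover have "f T = card {y \<in> A - T. E x y} + (\<Sum>u\<in>B. card {y \<in> A - T. E u y})"
      unfolding f_def B_def by (rule sum.remove[OF fT x])
    moreover have "f B \<le> f T" using max[of B] T B by auto
    moreover have "{u \<in> B. E u x} = {y \<in> T. E x y}" using B sym irr by auto
    ultimately show ?thesis by simp
  qed
  have "card {y \<in> A. E x y} \<le> 2 * card {y \<in> A. E x y \<and> (x \<in> S \<longleftrightarrow> y \<notin> S)}" if x: "x \<in> A" for x
  proof -
    define T where "T = (if x \<in> S then S else A - S)"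
    have T: "T \<subseteq> A" "x \<in> T" "f T = f S" using x S compl by (auto simp: T_def)
    have "{y \<in> A. E x y} = {y \<in> T. E x y} \<union> {y \<in> A - T. E x y}" using T by auto
    then have "card {y \<in> A. E x y} \<le> card {y \<in> T. E x y} + card {y \<in> A - T. E x y}"
      by (simp only: card_Un_le)
    also have "{y \<in> A - T. E x y} = {y \<in> A. E x y \<and> (x \<in> S \<longleftrightarrow> y \<notin> S)}"
      using S(1) x by (auto simp: T_def)
    finally show ?thesis using local_max[OF T(1,3,2)] \<open>{y \<in> A - T. E x y} = _\<close> by simp
  qed
  then show ?thesis by blast
qed

section \<open>The extremal bound\<close>

lemma contains_cycleI:
  assumes "distinct xs" "length xs = m" "m \<ge> 2" "set xs \<subseteq> verts G"
    and "successively (\<lambda>x y. {x, y} \<in> edges G) xs" "{last xs, hd xs} \<in> edges G"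
  shows "contains_copy G (cycle_graph m)"
  unfolding contains_copy_def
proof (intro exI[of _ "(!) xs"] conjI ballI)
  show "inj_on ((!) xs) (verts (cycle_graph m))"
    using assms(1,2) by (auto simp: cycle_graph_def inj_on_def nth_eq_iff_index_eq)
  show "(!) xs ` verts (cycle_graph m) \<subseteq> verts G" using assms(2,4) by (auto simp: cycle_graph_def)
  fix e assume "e \<in> edges (cycle_graph m)"
  then obtain i where i: "i < m" "e = {i, Suc i mod m}" by (auto simp: cycle_graph_def)
  show "(!) xs ` e \<in> edges G"
  proof (cases "Suc i = m")
    case True
    moreover have "xs \<noteq> []" using assms(2,3) by auto
    ultimately have "xs ! i = last xs" "xs ! 0 = hd xs" using assms(2) by (auto simp: last_conv_nth hd_conv_nth)
    then show ?thesis using True i assms(6) by simp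
  next
    case False
    then show ?thesis using i successively_nth[OF assms(5), of i] assms(2) by simp
  qed
qed

lemma sum_degrees:
  assumes "finite_simple_graph G"
  shows "(\<Sum>x\<in>verts G. card {y \<in> verts G. {x, y} \<in> edges G}) = 2 * card (edges G)"
proof -
  have fin: "finite (verts G)" and e: "\<And>e. e \<in> edges G \<Longrightarrow> e \<subseteq> verts G \<and> card e = 2"
    using assms by (auto simp: finite_simple_graph_def)
  have "edges G \<subseteq> Pow (verts G)" using e by auto
  then have finE: "finite (edges G)" using fin by (auto intro: finite_subset)
  have "card {y \<in> verts G. {x, y} \<in> edges G} = card {a \<in> edges G. x \<in> a}" for x
  proof (rule bij_betw_same_card[of "\<lambda>y. {x, y}"])
    show "bij_betw (\<lambda>y. {x, y}) {y \<in> verts G. {x, y} \<in> edges G} {a \<in> edges G. x \<in> a}"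
      unfolding bij_betw_def
    proof
      show "inj_on (\<lambda>y. {x, y}) {y \<in> verts G. {x, y} \<in> edges G}"
        by (auto simp: inj_on_def doubleton_eq_iff)
      show "(\<lambda>y. {x, y}) ` {y \<in> verts G. {x, y} \<in> edges G} = {a \<in> edges G. x \<in> a}"
      proof (intro equalityI subsetI)
        fix a assume a: "a \<in> {a \<in> edges G. x \<in> a}"
        then obtain y where "a = {x, y}" using e[of a] by (auto simp: card_2_iff)
        then show "a \<in> (\<lambda>y. {x, y}) ` {y \<in> verts G. {x, y} \<in> edges G}" using a e[of a] by auto
      qed auto
    qed
  qed
  then have "(\<Sum>x\<in>verts G. card {y \<in> verts G. {x, y} \<in> edges G}) = (\<Sum>x\<in>verts G. card {a \<in> edges G. x \<in> a})"
    by simp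
  also have "\<dots> = (\<Sum>a\<in>edges G. card {x \<in> verts G. x \<in> a})" using fin finE by (rule sum_card_swap)
  also have "\<dots> = (\<Sum>a\<in>edges G. 2)"
  proof (rule sum.cong[OF refl])
    fix a assume "a \<in> edges G"
    then have "{x \<in> verts G. x \<in> a} = a" "card a = 2" using e by auto
    then show "card {x \<in> verts G. x \<in> a} = 2" by simp
  qed
  finally show ?thesis by simp
qed

text \<open>The square of \<open>8 * sqrt 5\<close> is 320, while the left side of the growth
  condition is at most \<open>64 * k * ln k * N\<^sup>2\<close>, hence a fifth of
  \<open>d\<^sup>2\<close>. The factors on the right are close to \<open>d / 4\<close> and
  \<open>d\<close>; \<open>99 / 400\<close> and \<open>9 / 10\<close> absorb the rounding and the
  terms of order \<open>k\<^sup>2 * 5 ^ k\<close>, and their product still exceeds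
  \<open>1 / 5\<close>.\<close>

lemma degree_bounds:
  fixes k d :: nat and N :: real
  assumes k: "2 \<le> k" and N: "real ((20 * k) ^ (4 * k ^ 2 + 2 * k)) \<le> N"
    and d: "8 * sqrt 5 * sqrt (real k * ln (real k)) * N \<le> real d"
  shows "k < d div 8" "N \<le> real d"
    and "N\<^sup>2 * (8 * real k * (2 + ln (4 * real k)))
      \<le> 2 * real (d div 8) * (real d - 4 * real k - 8 * real k * real (2 * k * 5 ^ k + k + 1))"
proof -
  have ln2: "2 / 3 \<le> ln (2::real)" by (rule ln2_ge_two_thirds)
  have lnk: "ln 2 \<le> ln (real k)" using k by simp
  then have lnk': "2 / 3 \<le> ln (real k)" using ln2 by linarith
  have kl: "1 \<le> real k * ln (real k)"
  proof -
    have "2 * (2 / 3) \<le> real k * ln (real k)" using k lnk' by (intro mult_mono) auto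
    then show ?thesis by simp
  qed
  have N0: "0 \<le> N" using N by (meson of_nat_0_le_iff order_trans)
  have "1 \<le> sqrt 5 * sqrt (real k * ln (real k))" using kl by (simp flip: real_sqrt_mult)
  then have "1 \<le> 8 * sqrt 5 * sqrt (real k * ln (real k))" by linarith
  then have "1 * N \<le> 8 * sqrt 5 * sqrt (real k * ln (real k)) * N" using N0 by (rule mult_right_mono)
  then show Nd: "N \<le> real d" using d by simp
  have d2: "320 * (real k * ln (real k)) * N\<^sup>2 \<le> (real d)\<^sup>2"
  proof -
    have "(8 * sqrt 5 * sqrt (real k * ln (real k)) * N)\<^sup>2 \<le> (real d)\<^sup>2"
      using d N0 kl by (intro power_mono) auto
    then show ?thesis using kl by (simp add: power_mult_distrib)
  qed
  have P: "(20 * k) ^ (k + 2) \<le> d"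
  proof -
    have "k + 2 \<le> 4 * k ^ 2 + 2 * k" using k by (simp add: power2_eq_square)
    then have "(20 * k) ^ (k + 2) \<le> (20 * k) ^ (4 * k ^ 2 + 2 * k)" using k by (intro power_increasing) auto
    then have "real ((20 * k) ^ (k + 2)) \<le> N" using N by (meson of_nat_le_iff order_trans)
    then show ?thesis using Nd by (meson of_nat_le_iff order_trans)
  qed
  \<comment> \<open>The 400 is \<open>20 ^ 2\<close>: of the \<open>k + 2\<close> factors
    \<open>20 * k\<close>, two give \<open>400 * k ^ 2\<close> and each of the others pays for a
    5.\<close>
  have P2: "400 * (k ^ 2 * 5 ^ k) \<le> d"
  proof -
    have "5 ^ k \<le> (20 * k) ^ k" using k by (intro power_mono) auto
    then have "(20 * k) ^ 2 * 5 ^ k \<le> (20 * k) ^ 2 * (20 * k) ^ k" by (rule mult_le_mono2)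
    also have "\<dots> = (20 * k) ^ (k + 2)" unfolding add.commute[of k 2] by (rule power_add[symmetric])
    finally show ?thesis using P by (simp add: power_mult_distrib)
  qed
  have k5: "k ^ 2 \<le> k ^ 2 * 5 ^ k" "2 * k \<le> k ^ 2" using k by (auto simp: power2_eq_square)
  have k5': "2 ^ 2 \<le> k ^ 2" "5 ^ 2 \<le> (5::nat) ^ k"
    using k by (intro power_mono power_increasing; simp)+
  define X where "X = k ^ 2 * 5 ^ k"
  have "2 ^ 2 * 5 ^ 2 \<le> X" unfolding X_def using k5' by (intro mult_le_mono)
  then have big: "40000 \<le> d" using P2 by (simp add: X_def)
  have "2 * k \<le> X" unfolding X_def using k5(2,1) by (rule order_trans)
  then show kd: "k < d div 8" using P2 k by (simp add: X_def)
  have small: "10 * (4 * k + 8 * k * (2 * k * 5 ^ k + k + 1)) \<le> d"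
  proof -
    have "8 * k * (2 * k * 5 ^ k + k + 1) = 16 * X + 8 * k ^ 2 + 8 * k"
      by (simp add: X_def power2_eq_square algebra_simps)
    then have "4 * k + 8 * k * (2 * k * 5 ^ k + k + 1) \<le> 30 * X"
      using k5(1)[folded X_def] k5(2) by linarith
    then show ?thesis using P2 by (simp add: X_def)
  qed
  then have "real (10 * (4 * k + 8 * k * (2 * k * 5 ^ k + k + 1))) \<le> real d" by (simp only: of_nat_le_iff)
  then have small': "real d * (9 / 10) \<le> real d - 4 * real k - 8 * real k * real (2 * k * 5 ^ k + k + 1)"
    by (simp add: algebra_simps)
  have "d \<le> 8 * (d div 8) + 7" by presburger
  then have "real d \<le> real (8 * (d div 8) + 7)" by (simp only: of_nat_le_iff)
  then have s: "real d * (99 / 400) \<le> 2 * real (d div 8)" using big by simp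
  have "ln (4 * real k) = 2 * ln 2 + ln (real k)"
  proof -
    have "ln (4 * real k) = ln 4 + ln (real k)" using k by (simp add: ln_mult)
    moreover have "ln (4::real) = 2 * ln 2" using ln_realpow[of 2 2] by simp
    ultimately show ?thesis by simp
  qed
  \<comment> \<open>From \<open>2 \<le> 3 * ln 2\<close> and \<open>ln 2 \<le> ln k\<close>.\<close>
  then have "2 + ln (4 * real k) \<le> 8 * ln (real k)" using lnk ln2 by linarith
  then have "8 * real k * (2 + ln (4 * real k)) \<le> 8 * real k * (8 * ln (real k))" by (intro mult_left_mono) auto
  then have "N\<^sup>2 * (8 * real k * (2 + ln (4 * real k))) \<le> N\<^sup>2 * (8 * real k * (8 * ln (real k)))"
    by (rule mult_left_mono) simp
  also have "\<dots> = (1 / 5) * (320 * (real k * ln (real k)) * N\<^sup>2)" by simp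
  also have "\<dots> \<le> (1 / 5) * (real d)\<^sup>2" using d2 by simp
  also have "\<dots> \<le> (real d * (99 / 400)) * (real d * (9 / 10))" by (simp add: power2_eq_square)
  also have "\<dots> \<le> 2 * real (d div 8) * (real d - 4 * real k - 8 * real k * real (2 * k * 5 ^ k + k + 1))"
    by (intro mult_mono s small') simp_all
  finally show "N\<^sup>2 * (8 * real k * (2 + ln (4 * real k)))
      \<le> 2 * real (d div 8) * (real d - 4 * real k - 8 * real k * real (2 * k * 5 ^ k + k + 1))" .
qed

theorem theorem1:
  fixes k n :: nat and G :: "'a ugraph"
  assumes "k \<ge> 2"
    and "finite_simple_graph G"
    and "card (verts G) = n"
    and "n \<ge> (20 * k) ^ (4 * k ^ 3 + 2 * k ^ 2)"
    and "real (card (edges G)) >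
           16 * sqrt 5 * sqrt (real k * ln (real k)) * real n powr (1 + 1 / real k)
           + 8000 * real k ^ 4 * real n powr (1 + (2 * real k - 1) / (2 * real k ^ 2))"
  shows "contains_copy G (cycle_graph (2 * k))"
proof -
  note k = assms(1) and G = assms(2) and n = assms(3)
  define N where "N = real n powr (1 / real k)"
  \<comment> \<open>The average degree exceeds \<open>2 * \<delta>\<close>, the minimum degree in
    \<open>A\<close> exceeds \<open>\<delta>\<close>, and the cut keeps at least half of it: this is
    how \<open>16 * sqrt 5\<close> becomes the \<open>8 * sqrt 5\<close> of
    \<open>degree_bounds\<close>.\<close>
  define \<delta> where "\<delta> = 16 * sqrt 5 * sqrt (real k * ln (real k)) * N"
  define E0 where "E0 x y \<longleftrightarrow> {x, y} \<in> edges G" for x y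
  have fin: "finite (verts G)" and edge: "\<And>e. e \<in> edges G \<Longrightarrow> e \<subseteq> verts G \<and> card e = 2"
    using G by (auto simp: finite_simple_graph_def)
  have "0 < (20 * k) ^ (4 * k ^ 3 + 2 * k ^ 2)" using k by simp
  then have npos: "0 < n" using assms(4) by linarith
  have Nk: "N ^ k = real n"
    using npos k by (simp add: N_def powr_powr flip: powr_realpow)
  have Nge: "real ((20 * k) ^ (4 * k ^ 2 + 2 * k)) \<le> N"
  proof (rule power_le_imp_le_base)
    have "(4 * k ^ 2 + 2 * k) * k = 4 * k ^ 3 + 2 * k ^ 2"
      by (simp add: power2_eq_square power3_eq_cube algebra_simps)
    then have "((20 * k) ^ (4 * k ^ 2 + 2 * k)) ^ k \<le> n"
      using assms(4) by (simp only: power_mult[symmetric])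
    then have "real (((20 * k) ^ (4 * k ^ 2 + 2 * k)) ^ k) \<le> N ^ k" unfolding Nk by (simp only: of_nat_le_iff)
    then show "real ((20 * k) ^ (4 * k ^ 2 + 2 * k)) ^ Suc (k - 1) \<le> N ^ Suc (k - 1)" using k by simp
  qed (simp add: N_def)
  have "\<delta> * real n < real (card (edges G))"
  proof -
    have "real n powr (1 + 1 / real k) = N * real n" using npos by (simp add: N_def powr_add)
    then have "\<delta> * real n = 16 * sqrt 5 * sqrt (real k * ln (real k)) * real n powr (1 + 1 / real k)"
      by (simp add: \<delta>_def)
    moreover have "0 \<le> 8000 * real k ^ 4 * real n powr (1 + (2 * real k - 1) / (2 * real k ^ 2))" by simp
    ultimately show ?thesis using assms(5) by linarith
  qed
  then have "2 * \<delta> * real (card (verts G)) < real (\<Sum>x\<in>verts G. card {y \<in> verts G. E0 x y})"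
    unfolding E0_def sum_degrees[OF G] n by simp
  moreover have E0sym: "E0 y x" if "E0 x y" for x y using that by (simp add: E0_def insert_commute)
  moreover have E0irr: "\<not> E0 x x" for x using edge[of "{x, x}"] by (auto simp: E0_def)
  ultimately obtain A where A: "A \<subseteq> verts G" "A \<noteq> {}" "\<And>x. x \<in> A \<Longrightarrow> \<delta> < card {y \<in> A. E0 x y}"
    using min_degree_subset[OF fin, of E0 \<delta>] by blast
  have finA: "finite A" using A(1) fin by (rule finite_subset)
  have "\<exists>S. \<forall>x\<in>A. card {y \<in> A. E0 x y} \<le> 2 * card {y \<in> A. E0 x y \<and> (x \<in> S \<longleftrightarrow> y \<notin> S)}"
    using finA E0sym E0irr by (rule max_cut)
  then obtain S where S: "\<And>x. x \<in> A \<Longrightarrow> card {y \<in> A. E0 x y} \<le> 2 * card {y \<in> A. E0 x y \<and> (x \<in> S \<longleftrightarrow> y \<notin> S)}"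
    by blast
  define E where "E x y \<longleftrightarrow> x \<in> A \<and> y \<in> A \<and> E0 x y \<and> (x \<in> S \<longleftrightarrow> y \<notin> S)" for x y
  define d where "d = nat \<lceil>\<delta> / 2\<rceil>"
  have deg: "d \<le> card {y. E x y}" if x: "x \<in> A" for x
  proof -
    have "{y. E x y} = {y \<in> A. E0 x y \<and> (x \<in> S \<longleftrightarrow> y \<notin> S)}" using x by (auto simp: E_def)
    then have "\<delta> < 2 * real (card {y. E x y})" using A(3)[OF x] S[OF x] by simp
    then show ?thesis unfolding d_def by (simp add: nat_le_iff ceiling_le_iff)
  qed
  have "\<delta> / 2 \<le> real d" unfolding d_def by linarith
  then have d: "8 * sqrt 5 * sqrt (real k * ln (real k)) * N \<le> real d"
    unfolding \<delta>_def by (simp add: algebra_simps)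
  have cardA: "real (card A) \<le> N ^ k" unfolding Nk n[symmetric] using card_mono[OF fin A(1)] by simp
  obtain x0 where x0: "x0 \<in> A" using A(2) by blast
  have "\<exists>xs. length xs = 2 * k \<and> distinct xs \<and> successively E xs \<and> E (last xs) (hd xs)"
  proof (rule bipartite_min_degree_cycle[OF finA x0, where d = d and N = N and S = S])
    show "E y x" if "E x y" for x y using that E0sym by (auto simp: E_def)
    show "x \<in> S \<longleftrightarrow> y \<notin> S" if "E x y" for x y using that by (simp add: E_def)
    show "x \<in> A" if "E x y" for x y using that by (simp add: E_def)
    show "0 \<le> N" by (simp add: N_def)
  qed (use deg k cardA degree_bounds[OF k Nge d] in auto)
  then obtain xs where xs: "length xs = 2 * k" "distinct xs" "successively E xs" "E (last xs) (hd xs)" by blast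
  show ?thesis
  proof (rule contains_cycleI[OF xs(2,1)])
    have "xs ! i \<in> A" if "i < 2 * k" for i
    proof (cases "Suc i < 2 * k")
      case True
      then show ?thesis using successively_nth[OF xs(3), of i] xs(1) by (simp add: E_def)
    next
      case False
      then have "i = length xs - 1" "xs \<noteq> []" using that xs(1) by auto
      then show ?thesis using xs(4) by (simp add: E_def last_conv_nth)
    qed
    then have "set xs \<subseteq> A" using xs(1) by (auto simp: in_set_conv_nth)
    then show "set xs \<subseteq> verts G" using A(1) by (rule subset_trans)
    show "successively (\<lambda>x y. {x, y} \<in> edges G) xs"
      using xs(3) by (rule successively_mono) (simp add: E_def E0_def)
    show "{last xs, hd xs} \<in> edges G" using xs(4) by (simp add: E_def E0_def)
  qed (use k in simp)
qed

end
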